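(* Let $t\ge0$, $n,l$ be nonnegative integers, and write $t=3u$, $3u+1$ or $3u+2$ with $u\ge0$ an integer. Then \[ \mathcal{M}(P_t\vee S_{1,n}\vee S_{1,l})\simeq \begin{cases} * & (t=3u),\\ S^{n+l+2u+1} & (t=3u+1),\\ S^{n+l+2u+2} & (t=3u+2), \end{cases} \] where $*$ denotes a point.
   Context: Graphs are regarded as $1$-dimensional simplicial complexes (simplices: vertices and edges). A discrete vector field $V$ on a graph $G$ is a set of pairs $(v,e)$ with $v$ a vertex and $e$ an edge containing $v$, such that every vertex and every edge of $G$ occurs in at most one pair of $V$. A $V$-path is a sequence $v_0,e_0,v_1,e_1,\dots,e_{k-1},v_k$ with $(v_i,e_i)\in V$ and $v_{i+1}\neq v_i$ the other endpoint of $e_i$; it is closed if $v_k=v_0$ and non-trivial if $k\ge1$. $V$ is a gradient vector field if it has no non-trivial closed $V$-path. A primitive gradient vector field is a single pair $\{(v,e)\}$. The Morse complex $\mathcal{M}(G)$ is the simplicial complex whose vertices are the primitive gradient vector fields of $G$, a set of them forming a simplex iff their union is a gradient vector field. Homotopy equivalence refers to geometric realizations. $P_t$ is the path with vertices $v_0,\dots,v_t$ and edges $\{v_{i-1},v_i\}$, $1\le i\le t$. The extended star graph $S_{m,n}$ is the one-point union, at a common vertex (the center), of $m$ paths of length $1$ and $n$ paths of length $2$. $P_t\vee S_{m,n}\vee S_{k,l}$ denotes the graph obtained from $P_t$, $S_{m,n}$, $S_{k,l}$ by identifying the center of $S_{m,n}$ with $v_0$ and the center of $S_{k,l}$ with $v_t$.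 *)

theory Defs
  imports "HOL-Analysis.Analysis"
begin

text \<open>
  An abstract simplicial complex is represented by the set of its (nonempty) simplices,
  its vertices being the points of its simplices.  The predicate is not called
  \<open>simplicial_complex\<close> because that name denotes geometric complexes in the library.
\<close>

definition abstract_complex :: "'a set set \<Rightarrow> bool" where
  "abstract_complex K \<longleftrightarrow>
     (\<forall>\<sigma>\<in>K. finite \<sigma> \<and> \<sigma> \<noteq> {}) \<and>
     (\<forall>\<sigma>\<in>K. \<forall>\<tau>. \<tau> \<noteq> {} \<and> \<tau> \<subseteq> \<sigma> \<longrightarrow> \<tau> \<in> K)"

text \<open>
  Geometric realization: points are given by their barycentric coordinates, and the topology
  is the weak (coherent) one, in which a set is open iff it meets every closed simplex in an
  open subset of that simplex.  Function spaces carry the product topology, which on a closed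
  simplex, only finitely many coordinates being nonzero there, is the Euclidean one.
\<close>

definition closed_simplex :: "'a set \<Rightarrow> ('a \<Rightarrow> real) set" where
  "closed_simplex \<sigma> = {x. (\<forall>v. 0 \<le> x v) \<and> (\<forall>v. v \<notin> \<sigma> \<longrightarrow> x v = 0) \<and> (\<Sum>v\<in>\<sigma>. x v) = 1}"

definition geometric_realization :: "'a set set \<Rightarrow> ('a \<Rightarrow> real) topology" where
  "geometric_realization K =
     topology (\<lambda>U. U \<subseteq> (\<Union>\<sigma>\<in>K. closed_simplex \<sigma>) \<and>
                   (\<forall>\<sigma>\<in>K. openin (top_of_set (closed_simplex \<sigma>)) (U \<inter> closed_simplex \<sigma>)))"

lemma openin_geometric_realization:
  "openin (geometric_realization K) U \<longleftrightarrow>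
     U \<subseteq> (\<Union>\<sigma>\<in>K. closed_simplex \<sigma>) \<and>
     (\<forall>\<sigma>\<in>K. openin (top_of_set (closed_simplex \<sigma>)) (U \<inter> closed_simplex \<sigma>))"
proof -
  let ?P = "\<lambda>U. U \<subseteq> (\<Union>\<sigma>\<in>K. closed_simplex \<sigma>) \<and>
                (\<forall>\<sigma>\<in>K. openin (top_of_set (closed_simplex \<sigma>)) (U \<inter> closed_simplex \<sigma>))"
  have "istopology ?P"
    unfolding istopology_def
  proof (intro conjI allI impI)
    fix S T assume S: "?P S" and T: "?P T"
    show "S \<inter> T \<subseteq> (\<Union>\<sigma>\<in>K. closed_simplex \<sigma>)" using S by blast
    show "\<forall>\<sigma>\<in>K. openin (top_of_set (closed_simplex \<sigma>)) (S \<inter> T \<inter> closed_simplex \<sigma>)"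
    proof
      fix \<sigma> assume "\<sigma> \<in> K"
      with S T have "openin (top_of_set (closed_simplex \<sigma>))
                       ((S \<inter> closed_simplex \<sigma>) \<inter> (T \<inter> closed_simplex \<sigma>))"
        by (intro openin_Int[of _ "S \<inter> closed_simplex \<sigma>"]) blast+
      then show "openin (top_of_set (closed_simplex \<sigma>)) (S \<inter> T \<inter> closed_simplex \<sigma>)"
        by (simp add: Int_ac)
    qed
  next
    fix \<U> assume \<U>: "\<forall>S\<in>\<U>. ?P S"
    then show "\<Union>\<U> \<subseteq> (\<Union>\<sigma>\<in>K. closed_simplex \<sigma>)" by blast
    show "\<forall>\<sigma>\<in>K. openin (top_of_set (closed_simplex \<sigma>)) (\<Union>\<U> \<inter> closed_simplex \<sigma>)"
    proof
      fix \<sigma> assume "\<sigma> \<in> K"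
      with \<U> have "openin (top_of_set (closed_simplex \<sigma>)) (\<Union>S\<in>\<U>. S \<inter> closed_simplex \<sigma>)"
        by (intro openin_Union) auto
      then show "openin (top_of_set (closed_simplex \<sigma>)) (\<Union>\<U> \<inter> closed_simplex \<sigma>)"
        by (simp only: Int_Union2)
    qed
  qed
  then show ?thesis
    unfolding geometric_realization_def by (simp add: topology_inverse')
qed

lemma closed_closed_simplex: "closed (closed_simplex \<sigma>)"
proof -
  have "closed_simplex \<sigma> =
          (\<Inter>v. {x. 0 \<le> x v}) \<inter> (\<Inter>v\<in>-\<sigma>. {x. x v = 0}) \<inter> {x. (\<Sum>v\<in>\<sigma>. x v) = 1}"
    by (auto simp: closed_simplex_def)
  moreover have "closed \<dots>"
    by (intro closed_Int closed_INT ballI closed_Collect_le closed_Collect_eq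
          continuous_intros continuous_on_product_coordinates)
  ultimately show ?thesis by simp
qed

lemma geometric_realization_finite:
  assumes "finite K"
  shows "geometric_realization K = top_of_set (\<Union>\<sigma>\<in>K. closed_simplex \<sigma>)"
proof (rule topology_eq[THEN iffD2], intro allI iffI)
  let ?R = "\<Union>\<sigma>\<in>K. closed_simplex \<sigma>"
  fix U
  {
    assume U: "openin (geometric_realization K) U"
    have "closed (closed_simplex \<sigma> - U)" if "\<sigma> \<in> K" for \<sigma>
    proof -
      have "closedin (top_of_set (closed_simplex \<sigma>)) (closed_simplex \<sigma> - U \<inter> closed_simplex \<sigma>)"
        using U that by (intro closedin_diff) (auto simp: openin_geometric_realization)
      then have "closed (closed_simplex \<sigma> - U \<inter> closed_simplex \<sigma>)"
        using closed_closed_simplex closedin_closed_trans by blast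
      then show ?thesis by (simp add: Diff_Int_distrib2 Diff_Int)
    qed
    then have "closed (\<Union>\<sigma>\<in>K. closed_simplex \<sigma> - U)"
      using assms by (intro closed_UN) auto
    moreover have "U = ?R \<inter> - (\<Union>\<sigma>\<in>K. closed_simplex \<sigma> - U)"
      using U by (auto simp: openin_geometric_realization)
    ultimately show "openin (top_of_set ?R) U"
      by (metis openin_open open_Compl)
  }
  {
    assume "openin (top_of_set ?R) U"
    then obtain T where T: "open T" "U = ?R \<inter> T"
      by (auto simp: openin_open)
    have "openin (top_of_set (closed_simplex \<sigma>)) (U \<inter> closed_simplex \<sigma>)" if "\<sigma> \<in> K" for \<sigma>
    proof -
      have "U \<inter> closed_simplex \<sigma> = closed_simplex \<sigma> \<inter> T" using T that by auto
      then show ?thesis using T(1) by (auto simp: openin_open)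
    qed
    then show "openin (geometric_realization K) U"
      using T by (auto simp: openin_geometric_realization)
  }
qed


text \<open>
  In the following definitions a graph \<open>G\<close> is an abstract complex of dimension at most one.
\<close>

definition edges :: "'a set set \<Rightarrow> 'a set set" where
  "edges G = {e \<in> G. card e = 2}"

definition discrete_vector_field :: "'a set set \<Rightarrow> ('a \<times> 'a set) set \<Rightarrow> bool" where
  "discrete_vector_field G V \<longleftrightarrow>
     (\<forall>(v, e)\<in>V. {v} \<in> G \<and> e \<in> edges G \<and> v \<in> e) \<and> inj_on fst V \<and> inj_on snd V"

text \<open>
  A path is given by its list \<open>vs\<close> of vertices and its list \<open>es\<close> of edges, so that \<open>length es\<close>
  is the number of its steps.
\<close>

definition V_path :: "('a \<times> 'a set) set \<Rightarrow> 'a list \<Rightarrow> 'a set list \<Rightarrow> bool" where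
  "V_path V vs es \<longleftrightarrow>
     length vs = Suc (length es) \<and>
     (\<forall>i<length es. (vs ! i, es ! i) \<in> V \<and> vs ! Suc i \<in> es ! i \<and> vs ! Suc i \<noteq> vs ! i)"

definition gradient_vector_field :: "'a set set \<Rightarrow> ('a \<times> 'a set) set \<Rightarrow> bool" where
  "gradient_vector_field G V \<longleftrightarrow>
     discrete_vector_field G V \<and>
     \<not> (\<exists>vs es. V_path V vs es \<and> 1 \<le> length es \<and> last vs = hd vs)"

definition primitive_gradient_vector_field :: "'a set set \<Rightarrow> ('a \<times> 'a set) set \<Rightarrow> bool" where
  "primitive_gradient_vector_field G V \<longleftrightarrow>
     gradient_vector_field G V \<and> (\<exists>v e. V = {(v, e)})"

definition morse_complex :: "'a set set \<Rightarrow> ('a \<times> 'a set) set set set" where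
  "morse_complex G =
     {S. finite S \<and> S \<noteq> {} \<and> (\<forall>V\<in>S. primitive_gradient_vector_field G V) \<and>
         gradient_vector_field G (\<Union>S)}"

lemma gradient_vector_field_subset:
  assumes "gradient_vector_field G V" "W \<subseteq> V"
  shows "gradient_vector_field G W"
proof -
  have "V_path V vs es" if "V_path W vs es" for vs es
    using that assms(2) by (auto simp: V_path_def)
  moreover have "discrete_vector_field G W"
    using assms by (auto simp: gradient_vector_field_def discrete_vector_field_def
        intro: inj_on_subset)
  ultimately show ?thesis
    using assms(1) unfolding gradient_vector_field_def by blast
qed

lemma abstract_complex_morse_complex: "abstract_complex (morse_complex G)"
  unfolding abstract_complex_def
proof (intro conjI ballI allI impI)
  fix S assume S: "S \<in> morse_complex G"
  then show "finite S" "S \<noteq> {}" by (simp_all add: morse_complex_def)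
  fix T assume T: "T \<noteq> {} \<and> T \<subseteq> S"
  have "gradient_vector_field G (\<Union>T)"
  proof (rule gradient_vector_field_subset)
    show "gradient_vector_field G (\<Union>S)" using S by (simp add: morse_complex_def)
    show "\<Union>T \<subseteq> \<Union>S" using T by blast
  qed
  moreover have "finite T"
    using S T by (auto simp: morse_complex_def dest: finite_subset)
  ultimately show "T \<in> morse_complex G"
    using S T by (auto simp: morse_complex_def)
qed


definition path_graph :: "nat \<Rightarrow> nat set set" where
  "path_graph t = {{i} | i. i \<le> t} \<union> {{i - 1, i} | i. 1 \<le> i \<and> i \<le> t}"

text \<open>
  The extended star: \<open>Leaf i\<close> is the end of the \<open>i\<close>-th path of length 1, while \<open>Mid j\<close> and
  \<open>Tip j\<close> are the middle vertex and the end of the \<open>j\<close>-th path of length 2.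
\<close>

datatype star_vertex = Center | Leaf nat | Mid nat | Tip nat

definition extended_star :: "nat \<Rightarrow> nat \<Rightarrow> star_vertex set set" where
  "extended_star m n =
     {{Center}} \<union>
     (\<Union>i<m. {{Leaf i}, {Center, Leaf i}}) \<union>
     (\<Union>j<n. {{Mid j}, {Tip j}, {Center, Mid j}, {Mid j, Tip j}})"

text \<open>
  \<open>path_wedge_stars t m n k l\<close> is the image of the disjoint union of \<open>P\<^sub>t\<close>, \<open>S\<^bsub>m,n\<^esub>\<close> and \<open>S\<^bsub>k,l\<^esub>\<close>
  under the map \<open>attach_centers t\<close>, which identifies the first center with the vertex \<open>0\<close> and
  the second one with the vertex \<open>t\<close> of the path, and is injective otherwise.
\<close>

type_synonym wedge_vertex = "nat + (star_vertex + star_vertex)"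

definition attach_centers :: "nat \<Rightarrow> wedge_vertex \<Rightarrow> wedge_vertex" where
  "attach_centers t x =
     (if x = Inr (Inl Center) then Inl 0
      else if x = Inr (Inr Center) then Inl t
      else x)"

definition disjoint_union3 ::
  "'a set set \<Rightarrow> 'b set set \<Rightarrow> 'c set set \<Rightarrow> ('a + ('b + 'c)) set set" where
  "disjoint_union3 G H K =
     image Inl ` G \<union> image (Inr \<circ> Inl) ` H \<union> image (Inr \<circ> Inr) ` K"

definition path_wedge_stars :: "nat \<Rightarrow> nat \<Rightarrow> nat \<Rightarrow> nat \<Rightarrow> nat \<Rightarrow> wedge_vertex set set" where
  "path_wedge_stars t m n k l =
     image (attach_centers t) `
       disjoint_union3 (path_graph t) (extended_star m n) (extended_star k l)"

lemma abstract_complex_graphI: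
  assumes "\<And>\<sigma>. \<sigma> \<in> G \<Longrightarrow> \<exists>a b. \<sigma> = {a, b} \<and> {a} \<in> G \<and> {b} \<in> G"
  shows "abstract_complex G"
  unfolding abstract_complex_def
proof (intro conjI ballI allI impI)
  fix \<sigma> assume \<sigma>: "\<sigma> \<in> G"
  then obtain a b where ab: "\<sigma> = {a, b}" "{a} \<in> G" "{b} \<in> G"
    using assms by blast
  show "finite \<sigma>" "\<sigma> \<noteq> {}" using ab by auto
  fix \<tau> assume "\<tau> \<noteq> {} \<and> \<tau> \<subseteq> \<sigma>"
  then have "\<tau> = {a} \<or> \<tau> = {b} \<or> \<tau> = {a, b}"
    using ab(1) by blast
  then show "\<tau> \<in> G" using ab \<sigma> by metis
qed

lemma abstract_complex_path_graph: "abstract_complex (path_graph t)"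
proof (rule abstract_complex_graphI)
  fix \<sigma> assume "\<sigma> \<in> path_graph t"
  then consider i where "\<sigma> = {i}" "i \<le> t" | i where "\<sigma> = {i - 1, i}" "1 \<le> i" "i \<le> t"
    by (auto simp: path_graph_def)
  then show "\<exists>a b. \<sigma> = {a, b} \<and> {a} \<in> path_graph t \<and> {b} \<in> path_graph t"
  proof cases
    case 1
    then show ?thesis by (intro exI[of _ i]) (simp add: path_graph_def)
  next
    case 2
    then have "{i - 1} \<in> path_graph t" "{i} \<in> path_graph t"
      by (auto simp: path_graph_def)
    then show ?thesis using 2(1) by blast
  qed
qed

lemma abstract_complex_extended_star: "abstract_complex (extended_star m n)"
proof (rule abstract_complex_graphI)
  let ?S = "extended_star m n"
  fix \<sigma> assume "\<sigma> \<in> ?S"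
  then consider x where "\<sigma> = {x}" "{x} \<in> ?S"
    | i where "\<sigma> = {Center, Leaf i}" "i < m"
    | j where "\<sigma> = {Center, Mid j}" "j < n"
    | j where "\<sigma> = {Mid j, Tip j}" "j < n"
    by (auto simp: extended_star_def)
  then show "\<exists>a b. \<sigma> = {a, b} \<and> {a} \<in> ?S \<and> {b} \<in> ?S"
  proof cases
    case 1
    then show ?thesis by (intro exI[of _ x]) simp
  next
    case 2
    then show ?thesis
      by (intro exI[of _ Center] exI[of _ "Leaf i"]) (auto simp: extended_star_def)
  next
    case 3
    then show ?thesis
      by (intro exI[of _ Center] exI[of _ "Mid j"]) (auto simp: extended_star_def)
  next
    case 4
    then show ?thesis
      by (intro exI[of _ "Mid j"] exI[of _ "Tip j"]) (auto simp: extended_star_def)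
  qed
qed

lemma abstract_complex_image:
  assumes "abstract_complex K"
  shows "abstract_complex (image f ` K)"
  unfolding abstract_complex_def
proof (intro conjI ballI allI impI)
  fix \<sigma> assume "\<sigma> \<in> image f ` K"
  then obtain \<rho> where \<rho>: "\<rho> \<in> K" "\<sigma> = f ` \<rho>" by blast
  show "finite \<sigma>" "\<sigma> \<noteq> {}" using \<rho> assms by (auto simp: abstract_complex_def)
  fix \<tau> assume \<tau>: "\<tau> \<noteq> {} \<and> \<tau> \<subseteq> \<sigma>"
  then obtain \<pi> where \<pi>: "\<pi> \<subseteq> \<rho>" "\<tau> = f ` \<pi>"
    using \<rho>(2) by (auto simp: subset_image_iff)
  then have "\<pi> \<in> K" using \<tau> \<rho>(1) assms unfolding abstract_complex_def by blast
  then show "\<tau> \<in> image f ` K" using \<pi>(2) by blast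
qed

lemma abstract_complex_Un:
  assumes "abstract_complex K" "abstract_complex L"
  shows "abstract_complex (K \<union> L)"
  unfolding abstract_complex_def
proof (intro conjI ballI allI impI)
  fix \<sigma> assume \<sigma>: "\<sigma> \<in> K \<union> L"
  then show "finite \<sigma>" "\<sigma> \<noteq> {}" using assms by (auto simp: abstract_complex_def)
  fix \<tau> assume "\<tau> \<noteq> {} \<and> \<tau> \<subseteq> \<sigma>"
  then show "\<tau> \<in> K \<union> L" using \<sigma> assms unfolding abstract_complex_def by (meson Un_iff)
qed

lemma abstract_complex_path_wedge_stars: "abstract_complex (path_wedge_stars t m n k l)"
proof -
  have "abstract_complex (disjoint_union3 (path_graph t) (extended_star m n) (extended_star k l))"
    unfolding disjoint_union3_def
    by (intro abstract_complex_Un abstract_complex_image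
        abstract_complex_path_graph abstract_complex_extended_star)
  then show ?thesis
    unfolding path_wedge_stars_def by (rule abstract_complex_image)
qed

lemma card_path_wedge_stars_le:
  assumes "\<sigma> \<in> path_wedge_stars t m n k l"
  shows "card \<sigma> \<le> 2"
proof -
  have [simp]: "card {a, b} \<le> 2" for a b :: 'z
    by (simp add: card_insert_if)
  show ?thesis
    using assms unfolding path_wedge_stars_def disjoint_union3_def path_graph_def extended_star_def
    by auto
qed

end

theory Submission
  imports Defs
begin

text \<open>
  The graph is a tree, so a discrete vector field on it is automatically a gradient field, and the
  Morse complex is the independence complex of the conflict graph of half-edges \<open>(v, e)\<close>, two of
  them being in conflict when they share their vertex or their edge.  In an independence complex a
  vertex \<open>v\<close> may be removed without changing the homotopy type if some other vertex \<open>u\<close> satisfies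
  \<open>N(u) \<subseteq> N(v)\<close>.  The leaf at a center dominates all half-edges at that center but one; this
  isolates the two leaves and cuts each arm and the path off the centers.  What remains of an arm
  folds to a single edge, and what remains of the path is a path on \<open>2t - 2\<close> vertices, which folds
  to disjoint edges, followed by an isolated vertex when \<open>3\<close> divides \<open>t\<close>.  An isolated vertex makes
  the complex a cone, while \<open>k + 1\<close> disjoint edges give the boundary of a cross-polytope, a
  \<open>k\<close>-sphere.  For \<open>t = 0\<close> the two centers coincide, and one leaf isolates the other.
\<close>

section \<open>Independence complexes\<close>

text \<open>The relation is tested on equal pairs too, so a point related to itself is no vertex;
  this is why \<open>conflict\<close> and \<open>half_conflict\<close> exclude equality.\<close>

definition independence_complex :: "'a set \<Rightarrow> ('a \<Rightarrow> 'a \<Rightarrow> bool) \<Rightarrow> 'a set set" where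
  "independence_complex X R =
     {S. finite S \<and> S \<noteq> {} \<and> S \<subseteq> X \<and> (\<forall>a\<in>S. \<forall>b\<in>S. \<not> R a b)}"

text \<open>
  A point lies in the realization iff its support is independent, so that membership is a
  condition on pairs of coordinates and no simplex has to be named.
\<close>

definition independent_points :: "'a set \<Rightarrow> ('a \<Rightarrow> 'a \<Rightarrow> bool) \<Rightarrow> ('a \<Rightarrow> real) set" where
  "independent_points X R =
     {x. (\<forall>v. 0 \<le> x v) \<and> (\<forall>v. v \<notin> X \<longrightarrow> x v = 0) \<and> (\<Sum>v\<in>X. x v) = 1 \<and>
         (\<forall>v w. R v w \<longrightarrow> x v = 0 \<or> x w = 0)}"

text \<open>For a finite complex the weak topology is the subspace topology, and every point lies in
  the closed simplex spanned by its support.\<close>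

lemma geometric_realization_independence_complex:
  assumes "finite X"
  shows "geometric_realization (independence_complex X R) = top_of_set (independent_points X R)"
proof -
  let ?K = "independence_complex X R"
  have "finite ?K"
    by (rule finite_subset[of _ "Pow X"]) (use assms in \<open>auto simp: independence_complex_def\<close>)
  moreover have "(\<Union>\<sigma>\<in>?K. closed_simplex \<sigma>) = independent_points X R"
  proof (intro equalityI subsetI)
    fix x assume "x \<in> (\<Union>\<sigma>\<in>?K. closed_simplex \<sigma>)"
    then obtain S where S: "S \<in> ?K" and x: "x \<in> closed_simplex S" by blast
    from S have SX: "S \<subseteq> X" and ind: "\<And>a b. a \<in> S \<Longrightarrow> b \<in> S \<Longrightarrow> \<not> R a b"
      by (auto simp: independence_complex_def)
    from x have nn: "\<And>v. 0 \<le> x v" and out: "\<And>v. v \<notin> S \<Longrightarrow> x v = 0" and one: "(\<Sum>v\<in>S. x v) = 1"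
      by (auto simp: closed_simplex_def)
    have "(\<Sum>v\<in>X. x v) = (\<Sum>v\<in>S. x v)"
      using SX out assms by (intro sum.mono_neutral_right) auto
    then show "x \<in> independent_points X R"
      using nn out one SX ind by (fastforce simp: independent_points_def)
  next
    fix x assume x: "x \<in> independent_points X R"
    define S where "S = {v. x v \<noteq> 0}"
    have SX: "S \<subseteq> X" using x by (auto simp: S_def independent_points_def)
    have one: "(\<Sum>v\<in>S. x v) = 1"
      using x sum.mono_neutral_right[OF assms SX, of x] by (auto simp: S_def independent_points_def)
    then have "S \<noteq> {}" by auto
    then have "S \<in> ?K"
      using SX x assms finite_subset[OF SX assms]
      by (auto simp: independence_complex_def independent_points_def S_def)
    moreover have "x \<in> closed_simplex S"
      using one x by (auto simp: closed_simplex_def independent_points_def S_def)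
    ultimately show "x \<in> (\<Union>\<sigma>\<in>?K. closed_simplex \<sigma>)" by blast
  qed
  ultimately show ?thesis by (simp add: geometric_realization_finite)
qed

section \<open>Folding: removal of dominated vertices\<close>

text \<open>
  When every neighbour of \<open>u\<close> is a neighbour of \<open>v\<close>, moving the weight of \<open>v\<close> linearly to \<open>u\<close> never
  leaves the realization.
\<close>

lemma independence_complex_fold:
  assumes fin: "finite X" and R: "symp R" and u: "u \<in> X" and v: "v \<in> X" and "u \<noteq> v"
    and dom: "\<And>w. w \<in> X \<Longrightarrow> R u w \<Longrightarrow> R v w"
  shows "geometric_realization (independence_complex X R)
           homotopy_equivalent_space geometric_realization (independence_complex (X - {v}) R)"
proof -
  let ?P = "independent_points X R" and ?Q = "independent_points (X - {v}) R"
  \<comment> \<open>At time \<open>s\<close> the fraction \<open>1 - s\<close> of the weight of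
    \<open>v\<close> has moved to \<open>u\<close>: time 1 is the identity, time 0 the
    retraction.\<close>
  define h where "h = (\<lambda>(s::real, x) i. if i = u then x u + (1 - s) * x v
                                  else if i = v then s * x v else (x i :: real))"
  have sum_h: "(\<Sum>i\<in>X. h (s, x) i) = (\<Sum>i\<in>X. x i)" for s x
  proof -
    have X: "X = insert u (insert v (X - {u, v}))" using u v by blast
    have "(\<Sum>i\<in>X - {u, v}. h (s, x) i) = (\<Sum>i\<in>X - {u, v}. x i)"
      by (rule sum.cong) (auto simp: h_def)
    then show ?thesis
      using \<open>u \<noteq> v\<close> fin by (subst (1 2) X) (simp add: h_def algebra_simps)
  qed
  have h_P: "h (s, x) \<in> ?P" if x: "x \<in> ?P" and s: "s \<in> {0..1}" for s x
  proof -
    have nn: "\<And>i. 0 \<le> x i" and out: "\<And>i. i \<notin> X \<Longrightarrow> x i = 0" and one: "(\<Sum>i\<in>X. x i) = 1"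
      and ind: "\<And>a b. R a b \<Longrightarrow> x a = 0 \<or> x b = 0"
      using x by (auto simp: independent_points_def)
    have sym: "R b a" if "R a b" for a b using that R by (blast dest: sympD)
    have zero: "h (s, x) a = 0" if "a \<noteq> u" "x a = 0" for a using that by (auto simp: h_def)
    \<comment> \<open>Only the coordinate \<open>u\<close> can become nonzero, so only pairs
      containing \<open>u\<close> matter. If \<open>x v\<close> is nonzero, each neighbour of
      \<open>u\<close> in \<open>X\<close> is a neighbour of \<open>v\<close> and therefore has
      weight zero.\<close>
    have hu: "h (s, x) u = 0 \<or> h (s, x) b = 0" if b: "R u b" for b
    proof (cases "x v = 0")
      case True
      then have "h (s, x) = x" by (auto simp: h_def fun_eq_iff)
      then show ?thesis using ind[OF b] by simp
    next
      case xv: False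
      have "b \<noteq> v"
        using dom[OF v] b ind xv by blast
      moreover have "b \<noteq> u"
        using dom[OF u] b sym dom[OF v] ind xv by blast
      moreover have "x b = 0"
        using dom[of b] b out ind xv by blast
      ultimately show ?thesis using zero by blast
    qed
    have "h (s, x) a = 0 \<or> h (s, x) b = 0" if ab: "R a b" for a b
    proof (cases "a = u \<or> b = u")
      case True
      then show ?thesis using hu ab sym by blast
    next
      case False
      then show ?thesis using ind[OF ab] zero by blast
    qed
    moreover have "0 \<le> h (s, x) i" for i
      using nn[of i] nn[of u] nn[of v] s by (auto simp: h_def)
    moreover have "h (s, x) i = 0" if "i \<notin> X" for i
      using that u out[of i] zero[of i] by blast
    ultimately show ?thesis
      using sum_h one by (auto simp: independent_points_def)
  qed
  have Q: "?Q = ?P \<inter> {x. x v = 0}"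
    using v fin by (auto simp: independent_points_def sum.remove[of X v])
  have coord: "continuous_on S (\<lambda>z. snd z i)" for S :: "(real \<times> ('a \<Rightarrow> real)) set" and i
    by (rule continuous_on_product_then_coordinatewise) (intro continuous_intros)
  have cont: "continuous_on ({0..1} \<times> ?P) h"
    unfolding h_def case_prod_beta
  proof (rule continuous_on_coordinatewise_then_product)
    fix i
    show "continuous_on ({0..1} \<times> ?P)
            (\<lambda>z. if i = u then snd z u + (1 - fst z) * snd z v
                 else if i = v then fst z * snd z v else snd z i)"
      by (cases "i = u"; cases "i = v") (auto intro!: continuous_intros coord)
  qed
  have cont0: "continuous_on ?P (\<lambda>x. h (0, x))"
    by (rule continuous_on_compose2[OF cont]) (auto intro!: continuous_intros)
  have h0Q: "h (0, x) \<in> ?Q" if "x \<in> ?P" for x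
    using h_P[OF that, of 0] \<open>u \<noteq> v\<close> by (simp add: Q) (simp add: h_def)
  have "top_of_set ?P homotopy_equivalent_space top_of_set ?Q"
  proof (rule deformation_retract_imp_homotopy_equivalent_space)
    show "homotopic_with (\<lambda>x. True) (top_of_set ?P) (top_of_set ?P) (\<lambda>x. h (0, x)) id"
      unfolding homotopic_with_def
    proof (intro exI conjI allI ballI)
      show "continuous_map (prod_topology (top_of_set {0..1}) (top_of_set ?P)) (top_of_set ?P) h"
        using cont h_P by auto
      show "h (1, x) = id x" for x by (auto simp: h_def)
    qed auto
    show "retraction_maps (top_of_set ?P) (top_of_set ?Q) (\<lambda>x. h (0, x)) id"
      unfolding retraction_maps_def using cont0 h0Q
      by (auto simp: Q h_def fun_eq_iff)
  qed
  then show ?thesis using fin by (simp add: geometric_realization_independence_complex)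
qed

text \<open>
  The points of \<open>D\<close> are removed in order of increasing rank: when \<open>v\<close> has its turn, neighbours of
  \<open>u\<close> in \<open>D\<close> of smaller rank are already gone and need not be neighbours of \<open>v\<close>.
\<close>

lemma independence_complex_fold_ranked:
  fixes rank :: "'a \<Rightarrow> nat"
  assumes "finite X" "symp R" "D \<subseteq> X"
    and "\<And>v. v \<in> D \<Longrightarrow>
           \<exists>u\<in>X - D. \<forall>w\<in>X. R u w \<longrightarrow> R v w \<or> w \<in> D \<and> rank w < rank v"
  shows "geometric_realization (independence_complex X R)
           homotopy_equivalent_space geometric_realization (independence_complex (X - D) R)"
  using assms
proof (induction "card D" arbitrary: X D)
  case 0
  then have "D = {}" using finite_subset[of D X] by auto
  then show ?case by (simp add: homotopy_equivalent_space_refl)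
next
  case (Suc k)
  have finD: "finite D" using Suc.prems finite_subset by blast
  have "D \<noteq> {}" using Suc.hyps(2) by auto
  then obtain v where v: "v \<in> D" and min: "\<And>w. w \<in> D \<Longrightarrow> rank v \<le> rank w"
    using arg_min_if_finite(1)[OF finD] arg_min_least[OF finD] by blast
  obtain u where u: "u \<in> X - D" and "\<forall>w\<in>X. R u w \<longrightarrow> R v w \<or> w \<in> D \<and> rank w < rank v"
    using Suc.prems(4)[OF v] by blast
  \<comment> \<open>Since \<open>v\<close> has least rank in \<open>D\<close>, the alternative with
    a smaller rank is impossible, and \<open>u\<close> dominates \<open>v\<close> outright.\<close>
  then have dom: "\<And>w. w \<in> X \<Longrightarrow> R u w \<Longrightarrow> R v w"
    using min not_less by blast
  have "geometric_realization (independence_complex X R)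
          homotopy_equivalent_space geometric_realization (independence_complex (X - {v}) R)"
    using independence_complex_fold[of X R u v] Suc.prems u v dom by blast
  moreover have "geometric_realization (independence_complex (X - {v}) R)
      homotopy_equivalent_space geometric_realization (independence_complex (X - {v} - (D - {v})) R)"
  proof (rule Suc.hyps(1))
    show "k = card (D - {v})" using Suc.hyps(2) v finD by simp
    show "finite (X - {v})" "symp R" "D - {v} \<subseteq> X - {v}" using Suc.prems by auto
    fix v' assume v': "v' \<in> D - {v}"
    \<comment> \<open>The dominating point lies outside all of \<open>D\<close>, so it is still
      present after \<open>v\<close> has been removed.\<close>
    then obtain u' where u': "u' \<in> X - D"
      "\<forall>w\<in>X. R u' w \<longrightarrow> R v' w \<or> w \<in> D \<and> rank w < rank v'"
      using Suc.prems(4)[of v'] by blast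
    then show "\<exists>u\<in>X - {v} - (D - {v}). \<forall>w\<in>X - {v}. R u w \<longrightarrow>
                 R v' w \<or> w \<in> D - {v} \<and> rank w < rank v'"
      using v by (intro bexI[of _ u']) auto
  qed
  moreover have "X - {v} - (D - {v}) = X - D" using v by blast
  ultimately show ?case using homotopy_eqv_trans by metis
qed

text \<open>The empty neighbourhood of \<open>u\<close> is contained in every other one, so all
  other vertices fold away and a single point is left.\<close>

lemma independence_complex_isolated:
  assumes fin: "finite X" and R: "symp R" and u: "u \<in> X" and iso: "\<And>w. w \<in> X \<Longrightarrow> \<not> R u w"
  shows "geometric_realization (independence_complex X R)
           homotopy_equivalent_space discrete_topology {()}"
proof -
  have "geometric_realization (independence_complex X R)
          homotopy_equivalent_space geometric_realization (independence_complex (X - (X - {u})) R)"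
    using assms by (intro independence_complex_fold_ranked[where rank = "\<lambda>_. 0"]) auto
  moreover have "X - (X - {u}) = {u}" using u by blast
  moreover have "geometric_realization (independence_complex {u} R)
                   homeomorphic_space discrete_topology {()}"
  proof -
    let ?p = "\<lambda>v. if v = u then 1 else 0 :: real"
    have "\<not> R u u" using iso u by blast
    then have "independent_points {u} R = {?p}"
      by (auto simp: independent_points_def fun_eq_iff split: if_splits)
    then have "geometric_realization (independence_complex {u} R) = top_of_set {?p}"
      by (simp add: geometric_realization_independence_complex)
    moreover have "homeomorphic_maps (top_of_set {?p}) (discrete_topology {()}) (\<lambda>_. ()) (\<lambda>_. ?p)"
      by (auto simp: homeomorphic_maps_def)
    ultimately show ?thesis
      unfolding homeomorphic_space_def by metis
  qed
  ultimately show ?thesis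
    using homeomorphic_imp_homotopy_equivalent_space homotopy_eqv_trans by metis
qed

section \<open>Spheres from perfect matchings\<close>

text \<open>
  The complex is the boundary of a cross-polytope with opposite vertices \<open>a i\<close> and \<open>b i\<close>; the
  coordinates \<open>x (a i) - x (b i)\<close> are radially projected onto the Euclidean sphere.
\<close>

lemma independence_complex_matching_atMost:
  fixes a b :: "nat \<Rightarrow> 'a"
  assumes inj: "inj_on a {..m}" "inj_on b {..m}" and disj: "a ` {..m} \<inter> b ` {..m} = {}"
    and R: "\<And>p q. p \<in> a ` {..m} \<union> b ` {..m} \<Longrightarrow> q \<in> a ` {..m} \<union> b ` {..m} \<Longrightarrow>
              R p q \<longleftrightarrow> (\<exists>i\<le>m. p = a i \<and> q = b i \<or> p = b i \<and> q = a i)"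
  shows "geometric_realization (independence_complex (a ` {..m} \<union> b ` {..m}) R)
           homeomorphic_space nsphere m"
proof -
  define X where "X = a ` {..m} \<union> b ` {..m}"
  define A where "A = inv_into {..m} a"
  define B where "B = inv_into {..m} b"
  have [simp]: "A (a i) = i" "B (b i) = i" if "i \<le> m" for i
    using inj that by (auto simp: A_def B_def)
  let ?P = "independent_points X R"
  have sumX: "(\<Sum>v\<in>X. x v) = (\<Sum>i\<le>m. x (a i) + x (b i))" for x :: "'a \<Rightarrow> real"
    unfolding X_def using inj disj
    by (simp add: sum.union_disjoint sum.reindex sum.distrib)
  have P_iff: "x \<in> ?P \<longleftrightarrow> (\<forall>v. 0 \<le> x v) \<and> (\<forall>v. v \<notin> X \<longrightarrow> x v = 0) \<and>
      (\<Sum>i\<le>m. x (a i) + x (b i)) = 1 \<and> (\<forall>i\<le>m. x (a i) = 0 \<or> x (b i) = 0)" for x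
  proof -
    have "(\<forall>v w. R v w \<longrightarrow> x v = 0 \<or> x w = 0) \<longleftrightarrow> (\<forall>i\<le>m. x (a i) = 0 \<or> x (b i) = 0)"
      if out: "\<forall>v. v \<notin> X \<longrightarrow> x v = 0"
    proof (intro iffI allI impI)
      fix i assume *: "\<forall>v w. R v w \<longrightarrow> x v = 0 \<or> x w = 0" "i \<le> m"
      then have "R (a i) (b i)" by (subst R) auto
      with * show "x (a i) = 0 \<or> x (b i) = 0" by blast
    next
      fix v w assume *: "\<forall>i\<le>m. x (a i) = 0 \<or> x (b i) = 0" "R v w"
      show "x v = 0 \<or> x w = 0"
      proof (cases "v \<in> X \<and> w \<in> X")
        case True
        then obtain i where "i \<le> m" "v = a i \<and> w = b i \<or> v = b i \<and> w = a i"
          using *(2) R[of v w] by (auto simp: X_def)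
        then show ?thesis using *(1) by blast
      qed (use out in blast)
    qed
    then show ?thesis unfolding independent_points_def sumX by blast
  qed
  let ?S = "{y. (\<Sum>i\<le>m. (y i)\<^sup>2) = 1 \<and> (\<forall>i>m. y i = (0::real))}"
  define N where "N = (\<lambda>x. sqrt (\<Sum>i\<le>m. (x (a i) - x (b i))\<^sup>2))"
  define f where "f = (\<lambda>x i. if i \<le> m then (x (a i) - x (b i)) / N x else 0)"
  \<comment> \<open>The inverse of \<open>f\<close>: positive parts of \<open>y\<close> go to the
    points \<open>a i\<close>, negative parts to the points \<open>b i\<close>, rescaled to total
    weight 1.\<close>
  define g where "g = (\<lambda>(y::nat \<Rightarrow> real) p.
     (if p \<in> a ` {..m} then max 0 (y (A p)) else if p \<in> b ` {..m} then max 0 (- y (B p)) else 0)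
       / (\<Sum>i\<le>m. \<bar>y i\<bar>))"
  have ga: "g y (a i) = max 0 (y i) / (\<Sum>i\<le>m. \<bar>y i\<bar>)" if "i \<le> m" for y i
    using that by (simp add: g_def)
  have gb: "g y (b i) = max 0 (- y i) / (\<Sum>i\<le>m. \<bar>y i\<bar>)" if "i \<le> m" for y i
    using that disj by (auto simp: g_def)
  \<comment> \<open>One of the two opposite weights vanishes, so the absolute value of their
    difference is their sum.\<close>
  have abs1: "(\<Sum>i\<le>m. \<bar>x (a i) - x (b i)\<bar>) = 1" if "x \<in> ?P" for x
  proof -
    have "(\<Sum>i\<le>m. \<bar>x (a i) - x (b i)\<bar>) = (\<Sum>i\<le>m. x (a i) + x (b i))"
    proof (rule sum.cong)
      fix i assume "i \<in> {..m}"
      then show "\<bar>x (a i) - x (b i)\<bar> = x (a i) + x (b i)"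
        using that unfolding P_iff by (smt (verit) atMost_iff)
    qed simp
    then show ?thesis using that unfolding P_iff by simp
  qed
  have Npos: "N x > 0" if "x \<in> ?P" for x
  proof -
    have "(\<Sum>i\<le>m. (x (a i) - x (b i))\<^sup>2) \<noteq> 0"
    proof
      assume "(\<Sum>i\<le>m. (x (a i) - x (b i))\<^sup>2) = 0"
      then have "\<forall>i\<le>m. x (a i) - x (b i) = 0"
        by (subst (asm) sum_nonneg_eq_0_iff) auto
      then have "(\<Sum>i\<le>m. \<bar>x (a i) - x (b i)\<bar>) = 0" by simp
      then show False using abs1[OF that] by simp
    qed
    then show ?thesis unfolding N_def
      by (simp add: sum_nonneg order_less_le)
  qed
  have spos: "(\<Sum>i\<le>m. \<bar>y i\<bar>) > 0" if "y \<in> ?S" for y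
  proof -
    have "(\<Sum>i\<le>m. \<bar>y i\<bar>) \<noteq> 0"
    proof
      assume "(\<Sum>i\<le>m. \<bar>y i\<bar>) = 0"
      then have "\<forall>i\<le>m. y i = 0"
        by (subst (asm) sum_nonneg_eq_0_iff) auto
      then have "(\<Sum>i\<le>m. (y i)\<^sup>2) = 0" by simp
      then show False using that by simp
    qed
    then show ?thesis by (simp add: sum_nonneg order_less_le)
  qed
  have coord: "continuous_on T (\<lambda>x. x i)" for T :: "('c \<Rightarrow> real) set" and i
    by (rule continuous_on_product_then_coordinatewise) (intro continuous_intros)
  have fP: "f x \<in> ?S" if "x \<in> ?P" for x
  proof -
    have "(\<Sum>i\<le>m. (f x i)\<^sup>2) = (\<Sum>i\<le>m. (x (a i) - x (b i))\<^sup>2) / (N x)\<^sup>2"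
      by (simp add: f_def power_divide sum_divide_distrib)
    also have "(N x)\<^sup>2 = (\<Sum>i\<le>m. (x (a i) - x (b i))\<^sup>2)"
      by (simp add: N_def sum_nonneg)
    finally have "(\<Sum>i\<le>m. (f x i)\<^sup>2) = 1"
      using Npos[OF that] by (simp add: N_def)
    then show ?thesis by (simp add: f_def)
  qed
  have gS: "g y \<in> ?P" if y: "y \<in> ?S" for y
    unfolding P_iff
  proof (intro conjI allI impI)
    have "(\<Sum>i\<le>m. g y (a i) + g y (b i)) = (\<Sum>i\<le>m. \<bar>y i\<bar> / (\<Sum>i\<le>m. \<bar>y i\<bar>))"
      by (rule sum.cong) (auto simp: ga gb add_divide_distrib[symmetric])
    also have "\<dots> = 1" using spos[OF y] by (simp add: sum_divide_distrib[symmetric])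
    finally show "(\<Sum>i\<le>m. g y (a i) + g y (b i)) = 1" .
    show "0 \<le> g y v" for v by (simp add: g_def sum_nonneg)
    show "g y v = 0" if "v \<notin> X" for v using that by (auto simp: g_def X_def)
    show "g y (a i) = 0 \<or> g y (b i) = 0" if "i \<le> m" for i using that by (auto simp: ga gb max_def)
  qed
  have gf: "g (f x) = x" if x: "x \<in> ?P" for x
  proof
    fix p
    \<comment> \<open>This factor lets \<open>g\<close> undo the division by \<open>N x\<close> in
      \<open>f\<close>.\<close>
    have s: "(\<Sum>i\<le>m. \<bar>f x i\<bar>) = 1 / N x"
      using Npos[OF x] abs1[OF x] by (simp add: f_def abs_divide sum_divide_distrib[symmetric])
    have pos: "0 \<le> x v" for v using x P_iff by blast
    consider i where "i \<le> m" "p = a i" | i where "i \<le> m" "p = b i" | "p \<notin> X"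
      unfolding X_def by blast
    then show "g (f x) p = x p"
    proof cases
      case 1
      then have "x (a i) = 0 \<or> x (b i) = 0" using x P_iff by blast
      then show ?thesis
        using 1 Npos[OF x] pos[of "a i"] pos[of "b i"] unfolding 1 ga[OF 1(1)] s
        by (auto simp: f_def max_def divide_simps)
    next
      case 2
      then have "x (a i) = 0 \<or> x (b i) = 0" using x P_iff by blast
      then show ?thesis
        using 2 Npos[OF x] pos[of "a i"] pos[of "b i"] unfolding 2 gb[OF 2(1)] s
        by (auto simp: f_def max_def divide_simps)
    next
      case 3
      then show ?thesis using x unfolding P_iff by (auto simp: g_def X_def)
    qed
  qed
  have fg: "f (g y) = y" if y: "y \<in> ?S" for y
  proof
    fix i
    let ?s = "\<Sum>i\<le>m. \<bar>y i\<bar>"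
    have d: "g y (a i) - g y (b i) = y i / ?s" if "i \<le> m" for i
      using that by (auto simp: ga gb diff_divide_distrib[symmetric] max_def)
    have "N (g y) = sqrt ((\<Sum>i\<le>m. (y i)\<^sup>2) / ?s\<^sup>2)"
      unfolding N_def by (simp add: d power_divide sum_divide_distrib)
    also have "\<dots> = 1 / ?s" using y spos[OF y] by (simp add: real_sqrt_divide)
    finally have "N (g y) = 1 / ?s" .
    then show "f (g y) i = y i"
      using spos[OF y] y by (auto simp: f_def d)
  qed
  have cf: "continuous_on ?P f"
  proof (rule continuous_on_coordinatewise_then_product)
    fix i
    have "continuous_on ?P N" unfolding N_def by (intro continuous_intros coord)
    moreover have "\<forall>x\<in>?P. N x \<noteq> 0" using Npos by fastforce
    ultimately show "continuous_on ?P (\<lambda>x. f x i)"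
      unfolding f_def by (cases "i \<le> m") (auto intro!: continuous_intros coord)
  qed
  have cg: "continuous_on ?S g"
  proof (rule continuous_on_coordinatewise_then_product)
    fix p
    have "\<forall>y\<in>?S. (\<Sum>i\<le>m. \<bar>y i\<bar>) \<noteq> 0" using spos by fastforce
    moreover have "continuous_on ?S (\<lambda>y. if p \<in> a ` {..m} then max 0 (y (A p))
                     else if p \<in> b ` {..m} then max 0 (- y (B p)) else 0)"
      by (cases "p \<in> a ` {..m}"; cases "p \<in> b ` {..m}") (auto intro!: continuous_intros coord)
    ultimately show "continuous_on ?S (\<lambda>y. g y p)"
      unfolding g_def by (intro continuous_intros coord)
  qed
  have "nsphere m = top_of_set ?S"
    by (simp add: nsphere euclidean_product_topology)
  moreover have "geometric_realization (independence_complex X R) = top_of_set ?P"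
    by (simp add: geometric_realization_independence_complex X_def)
  moreover have "homeomorphic_maps (top_of_set ?P) (top_of_set ?S) f g"
    unfolding homeomorphic_maps_def using cf cg fP gS gf fg by auto
  ultimately show ?thesis
    unfolding X_def[symmetric] by (auto simp: homeomorphic_space_def)
qed

text \<open>An index-free form: the edges join \<open>p\<close> to \<open>b p\<close> for
  \<open>p\<close> in \<open>A\<close>, and an enumeration of \<open>A\<close> supplies the indices.
  The dimension is one less than the number of edges.\<close>

lemma independence_complex_matching:
  assumes card: "card A = Suc m" and inj: "inj_on b A" and disj: "A \<inter> b ` A = {}"
    and R: "\<And>p q. p \<in> A \<union> b ` A \<Longrightarrow> q \<in> A \<union> b ` A \<Longrightarrow>
              R p q \<longleftrightarrow> p \<in> A \<and> q = b p \<or> q \<in> A \<and> p = b q"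
  shows "geometric_realization (independence_complex (A \<union> b ` A) R) homeomorphic_space nsphere m"
proof -
  have "finite A" using card card.infinite by fastforce
  then obtain h where h: "bij_betw h {..m} A"
    using card ex_bij_betw_nat_finite[of A] by (auto simp: atLeast0LessThan lessThan_Suc_atMost)
  then have hA: "h ` {..m} = A" by (simp add: bij_betw_def)
  then have *: "(b \<circ> h) ` {..m} = b ` A"
    by (auto simp: image_comp[symmetric])
  have "geometric_realization (independence_complex (h ` {..m} \<union> (b \<circ> h) ` {..m}) R)
          homeomorphic_space nsphere m"
  proof (rule independence_complex_matching_atMost)
    show "inj_on h {..m}" "inj_on (b \<circ> h) {..m}"
      using h inj by (auto intro!: comp_inj_on simp: bij_betw_def)
    show "h ` {..m} \<inter> (b \<circ> h) ` {..m} = {}"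
      unfolding * hA by (rule disj)
    fix p q assume "p \<in> h ` {..m} \<union> (b \<circ> h) ` {..m}" "q \<in> h ` {..m} \<union> (b \<circ> h) ` {..m}"
    then have "R p q \<longleftrightarrow> p \<in> h ` {..m} \<and> q = b p \<or> q \<in> h ` {..m} \<and> p = b q"
      unfolding * hA by (rule R)
    then show "R p q \<longleftrightarrow> (\<exists>i\<le>m. p = h i \<and> q = (b \<circ> h) i \<or> p = (b \<circ> h) i \<and> q = h i)"
      by auto
  qed
  then show ?thesis unfolding * hA .
qed

text \<open>Barycentric coordinates are carried along \<open>\<phi>\<close> and its inverse and set
  to zero elsewhere. This serves to replace the vertices of the Morse complex, which are singleton
  fields, by labels.\<close>

lemma independence_complex_reindex:
  assumes fin: "finite H" and inj: "inj_on \<phi> H"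
    and R: "\<And>x y. x \<in> H \<Longrightarrow> y \<in> H \<Longrightarrow> R (\<phi> x) (\<phi> y) \<longleftrightarrow> S x y"
  shows "geometric_realization (independence_complex (\<phi> ` H) R)
           homeomorphic_space geometric_realization (independence_complex H S)"
proof -
  let ?P = "independent_points (\<phi> ` H) R" and ?Q = "independent_points H S"
  define \<psi> where "\<psi> = inv_into H \<phi>"
  have [simp]: "\<psi> (\<phi> h) = h" if "h \<in> H" for h using inj that by (simp add: \<psi>_def)
  define f where "f = (\<lambda>x h. if h \<in> H then x (\<phi> h) else (0::real))"
  define g where "g = (\<lambda>y p. if p \<in> \<phi> ` H then y (\<psi> p) else (0::real))"
  have coord: "continuous_on T (\<lambda>x. x i)" for T :: "('c \<Rightarrow> real) set" and i
    by (rule continuous_on_product_then_coordinatewise) (intro continuous_intros)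
  have "continuous_on ?P f"
  proof (rule continuous_on_coordinatewise_then_product)
    show "continuous_on ?P (\<lambda>x. f x h)" for h
      unfolding f_def by (cases "h \<in> H") (auto intro!: continuous_intros coord)
  qed
  moreover have "continuous_on ?Q g"
  proof (rule continuous_on_coordinatewise_then_product)
    show "continuous_on ?Q (\<lambda>y. g y p)" for p
      unfolding g_def by (cases "p \<in> \<phi> ` H") (auto intro!: continuous_intros coord)
  qed
  moreover have "f x \<in> ?Q" if "x \<in> ?P" for x
    using that R inj by (auto simp: independent_points_def f_def sum.reindex)
  moreover have "g y \<in> ?P" if y: "y \<in> ?Q" for y
  proof -
    have "g y v = 0 \<or> g y w = 0" if vw: "R v w" for v w
    proof (cases "v \<in> \<phi> ` H \<and> w \<in> \<phi> ` H")
      case True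
      then obtain a b where ab: "v = \<phi> a" "w = \<phi> b" "a \<in> H" "b \<in> H" by blast
      then have "y a = 0 \<or> y b = 0" using R vw y by (simp add: independent_points_def)
      then show ?thesis using ab by (auto simp: g_def)
    qed (auto simp: g_def)
    moreover have "(\<Sum>v\<in>\<phi> ` H. g y v) = (\<Sum>h\<in>H. y h)"
      using inj by (simp add: sum.reindex g_def)
    ultimately show ?thesis
      using y by (auto simp: independent_points_def g_def)
  qed
  moreover have "g (f x) = x" if "x \<in> ?P" for x
    using that by (auto simp: independent_points_def f_def g_def fun_eq_iff)
  moreover have "f (g y) = y" if "y \<in> ?Q" for y
    using that by (auto simp: independent_points_def f_def g_def fun_eq_iff)
  ultimately have "homeomorphic_maps (top_of_set ?P) (top_of_set ?Q) f g"
    unfolding homeomorphic_maps_def by auto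
  then show ?thesis
    using fin by (auto simp: homeomorphic_space_def geometric_realization_independence_complex)
qed

section \<open>Morse complexes of trees\<close>

definition half_edges :: "'a set set \<Rightarrow> ('a \<times> 'a set) set" where
  "half_edges G = {(v, e). e \<in> edges G \<and> v \<in> e}"

definition conflict :: "'a \<times> 'b \<Rightarrow> 'a \<times> 'b \<Rightarrow> bool" where
  "conflict p q \<longleftrightarrow> p \<noteq> q \<and> (fst p = fst q \<or> snd p = snd q)"

text \<open>That \<open>{v}\<close> lies in \<open>G\<close> follows from closure under faces, and
  injectivity of both projections is the absence of conflicts.\<close>

lemma discrete_vector_field_iff:
  assumes "abstract_complex G"
  shows "discrete_vector_field G V \<longleftrightarrow> V \<subseteq> half_edges G \<and> (\<forall>p\<in>V. \<forall>q\<in>V. \<not> conflict p q)"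
proof -
  have "{v} \<in> G" if "e \<in> edges G" "v \<in> e" for v e
    using assms that unfolding abstract_complex_def edges_def by blast
  then have "(\<forall>(v, e)\<in>V. {v} \<in> G \<and> e \<in> edges G \<and> v \<in> e) \<longleftrightarrow> V \<subseteq> half_edges G"
    by (auto simp: half_edges_def)
  moreover have "inj_on fst V \<and> inj_on snd V \<longleftrightarrow> (\<forall>p\<in>V. \<forall>q\<in>V. \<not> conflict p q)"
    by (auto simp: inj_on_def conflict_def)
  ultimately show ?thesis unfolding discrete_vector_field_def by blast
qed

text \<open>
  For a rooted tree, the distance to the root is such a function \<open>d\<close>.  A closed path would enter and
  leave a vertex of maximal \<open>d\<close> through the same edge, which would then lie in two pairs.
\<close>

definition unique_top_edges :: "'a set set \<Rightarrow> ('a \<Rightarrow> nat) \<Rightarrow> bool" where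
  "unique_top_edges G d \<longleftrightarrow>
     (\<forall>e\<in>edges G. \<forall>e'\<in>edges G. \<forall>v\<in>e \<inter> e'. (\<forall>w\<in>e \<union> e'. d w \<le> d v) \<longrightarrow> e = e')"

lemma no_closed_V_path:
  assumes top: "unique_top_edges G d"
    and V: "discrete_vector_field G V" and path: "V_path V vs es"
    and nontrivial: "1 \<le> length es" and closed: "last vs = hd vs"
  shows False
proof -
  define k where "k = length es"
  have k: "1 \<le> k" "length vs = Suc k"
    and step: "\<And>i. i < k \<Longrightarrow> (vs ! i, es ! i) \<in> V \<and> vs ! Suc i \<in> es ! i \<and> vs ! Suc i \<noteq> vs ! i"
    using path nontrivial by (auto simp: V_path_def k_def)
  have "vs \<noteq> []" using k by auto
  then have cl: "vs ! k = vs ! 0"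
    using closed k by (simp add: last_conv_nth hd_conv_nth)
  have edge: "es ! i \<in> edges G" "es ! i = {vs ! i, vs ! Suc i}" if "i < k" for i
  proof -
    have *: "es ! i \<in> edges G" "vs ! i \<in> es ! i"
      using V step[OF that] by (auto simp: discrete_vector_field_def)
    then have "card (es ! i) = 2" by (simp add: edges_def)
    then obtain a b where "es ! i = {a, b}" by (auto simp: card_2_iff)
    then show "es ! i \<in> edges G" "es ! i = {vs ! i, vs ! Suc i}"
      using * step[OF that] by auto
  qed
  \<comment> \<open>\<open>vs ! Suc j\<close> is a highest vertex of the path; maximising over
    \<open>Suc i\<close> makes it the end of a step.\<close>
  obtain j where j: "j < k" and *: "\<And>i. i < k \<Longrightarrow> d (vs ! Suc i) \<le> d (vs ! Suc j)"
  proof -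
    let ?D = "(\<lambda>i. d (vs ! Suc i)) ` {..<k}"
    have "Max ?D \<in> ?D" using k(1) by (intro Max_in) (auto simp: lessThan_empty_iff)
    then obtain j where "j < k" "Max ?D = d (vs ! Suc j)" by auto
    moreover have "d (vs ! Suc i) \<le> Max ?D" if "i < k" for i using that by (intro Max_ge) auto
    ultimately show thesis using that by metis
  qed
  have max: "d (vs ! i) \<le> d (vs ! Suc j)" if "i \<le> k" for i
  proof (cases i)
    case 0
    obtain k' where "k = Suc k'" using k(1) by (cases k) auto
    then show ?thesis using *[of k'] cl 0 by simp
  next
    case (Suc i')
    then show ?thesis using *[of i'] that by simp
  qed
  \<comment> \<open>The number of the step leaving \<open>vs ! Suc j\<close>. If that vertex is the
    last one, it is also the first, and the step has number 0.\<close>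
  define j' where "j' = (if Suc j = k then 0 else Suc j)"
  have j': "j' < k" "vs ! j' = vs ! Suc j" using j cl k by (auto simp: j'_def)
  have "es ! j = es ! j'"
  proof -
    have "es ! j \<in> edges G" "es ! j' \<in> edges G" using edge(1) j j' by blast+
    moreover have "vs ! Suc j \<in> es ! j \<inter> es ! j'"
      using edge(2)[OF j] edge(2)[OF j'(1)] j'(2) by simp
    moreover have "\<forall>w\<in>es ! j \<union> es ! j'. d w \<le> d (vs ! Suc j)"
      using edge(2)[OF j] edge(2)[OF j'(1)] max j j' by auto
    ultimately show ?thesis using top unfolding unique_top_edges_def by blast
  qed
  moreover have "inj_on snd V" using V by (simp add: discrete_vector_field_def)
  \<comment> \<open>An edge lies in at most one pair of \<open>V\<close>, so both steps start at the
    same vertex, although step \<open>j\<close> leaves its own.\<close>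
  ultimately have "vs ! j = vs ! j'"
    using step[OF j] step[OF j'(1)] inj_onD[of snd V "(vs ! j, es ! j)" "(vs ! j', es ! j')"] by simp
  then show False using step[OF j] j'(2) by simp
qed

text \<open>Without closed paths every discrete vector field is a gradient field, so being a simplex
  is a condition on pairs of half-edges. The relation is lifted to sets because the vertices are
  singletons.\<close>

lemma morse_complex_eq_independence_complex:
  assumes G: "abstract_complex G" and top: "unique_top_edges G d"
  shows "morse_complex G =
           independence_complex ((\<lambda>p. {p}) ` half_edges G) (\<lambda>V W. \<exists>p\<in>V. \<exists>q\<in>W. conflict p q)"
proof -
  have grad: "gradient_vector_field G V \<longleftrightarrow>
      V \<subseteq> half_edges G \<and> (\<forall>p\<in>V. \<forall>q\<in>V. \<not> conflict p q)" for V
  proof -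
    have "\<not> (\<exists>vs es. V_path V vs es \<and> 1 \<le> length es \<and> last vs = hd vs)"
      if "discrete_vector_field G V"
      using no_closed_V_path[OF top that] by blast
    then show ?thesis
      unfolding gradient_vector_field_def discrete_vector_field_iff[OF G, symmetric] by blast
  qed
  have prim: "primitive_gradient_vector_field G V \<longleftrightarrow> V \<in> (\<lambda>p. {p}) ` half_edges G" for V
    unfolding primitive_gradient_vector_field_def grad by (auto simp: conflict_def)
  show ?thesis
    unfolding morse_complex_def independence_complex_def prim grad
  proof (rule Collect_cong)
    fix S :: "('a \<times> 'a set) set set"
    have "(\<forall>V\<in>S. V \<in> (\<lambda>p. {p}) ` half_edges G) \<longleftrightarrow> S \<subseteq> (\<lambda>p. {p}) ` half_edges G"
      by blast
    moreover have "S \<subseteq> (\<lambda>p. {p}) ` half_edges G \<longrightarrow> \<Union>S \<subseteq> half_edges G"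
      by blast
    moreover have "(\<forall>p\<in>\<Union>S. \<forall>q\<in>\<Union>S. \<not> conflict p q) \<longleftrightarrow>
        (\<forall>V\<in>S. \<forall>W\<in>S. \<not> (\<exists>p\<in>V. \<exists>q\<in>W. conflict p q))"
      by blast
    ultimately show "(finite S \<and> S \<noteq> {} \<and> (\<forall>V\<in>S. V \<in> (\<lambda>p. {p}) ` half_edges G) \<and>
        \<Union>S \<subseteq> half_edges G \<and> (\<forall>p\<in>\<Union>S. \<forall>q\<in>\<Union>S. \<not> conflict p q)) \<longleftrightarrow>
      (finite S \<and> S \<noteq> {} \<and> S \<subseteq> (\<lambda>p. {p}) ` half_edges G \<and>
        (\<forall>V\<in>S. \<forall>W\<in>S. \<not> (\<exists>p\<in>V. \<exists>q\<in>W. conflict p q)))"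
      by argo
  qed
qed

section \<open>Half-edges of a path with two stars\<close>

text \<open>
  The half-edges of the graph, the flag telling the star at \<open>v\<^sub>0\<close> (false) from the one at \<open>v\<^sub>t\<close>
  (true).  Those of the path are numbered consecutively from \<open>v\<^sub>0\<close> to \<open>v\<^sub>t\<close>: the numbers \<open>2 i\<close> and
  \<open>2 i + 1\<close> belong to the edge between \<open>v\<^sub>i\<close> and its successor.
\<close>

datatype half =
    Leaf_end bool | Leaf_center bool
  | Arm_center bool nat | Arm_inner bool nat | Arm_outer bool nat | Arm_tip bool nat
  | Path_half nat

definition side :: "bool \<Rightarrow> star_vertex \<Rightarrow> wedge_vertex" where
  "side s x = Inr (if s then Inr x else Inl x)"

definition center :: "nat \<Rightarrow> bool \<Rightarrow> wedge_vertex" where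
  "center t s = Inl (if s then t else 0)"

fun half_vertex :: "nat \<Rightarrow> half \<Rightarrow> wedge_vertex" where
  "half_vertex t (Leaf_end s) = side s (Leaf 0)"
| "half_vertex t (Leaf_center s) = center t s"
| "half_vertex t (Arm_center s j) = center t s"
| "half_vertex t (Arm_inner s j) = side s (Mid j)"
| "half_vertex t (Arm_outer s j) = side s (Mid j)"
| "half_vertex t (Arm_tip s j) = side s (Tip j)"
| "half_vertex t (Path_half i) = Inl (Suc i div 2)"

fun half_edge :: "nat \<Rightarrow> half \<Rightarrow> wedge_vertex set" where
  "half_edge t (Leaf_end s) = {center t s, side s (Leaf 0)}"
| "half_edge t (Leaf_center s) = {center t s, side s (Leaf 0)}"
| "half_edge t (Arm_center s j) = {center t s, side s (Mid j)}"
| "half_edge t (Arm_inner s j) = {center t s, side s (Mid j)}"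
| "half_edge t (Arm_outer s j) = {side s (Mid j), side s (Tip j)}"
| "half_edge t (Arm_tip s j) = {side s (Mid j), side s (Tip j)}"
| "half_edge t (Path_half i) = {Inl (i div 2), Inl (Suc (i div 2))}"

fun valid_half :: "nat \<Rightarrow> nat \<Rightarrow> nat \<Rightarrow> half \<Rightarrow> bool" where
  "valid_half t n l (Leaf_end s) = True"
| "valid_half t n l (Leaf_center s) = True"
| "valid_half t n l (Arm_center s j) = (j < (if s then l else n))"
| "valid_half t n l (Arm_inner s j) = (j < (if s then l else n))"
| "valid_half t n l (Arm_outer s j) = (j < (if s then l else n))"
| "valid_half t n l (Arm_tip s j) = (j < (if s then l else n))"
| "valid_half t n l (Path_half i) = (i < 2 * t)"

definition halves :: "nat \<Rightarrow> nat \<Rightarrow> nat \<Rightarrow> half set" where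
  "halves t n l = {x. valid_half t n l x}"

definition half_conflict :: "nat \<Rightarrow> half \<Rightarrow> half \<Rightarrow> bool" where
  "half_conflict t x y \<longleftrightarrow> x \<noteq> y \<and> (half_vertex t x = half_vertex t y \<or> half_edge t x = half_edge t y)"

lemma side_eq_iff [simp]: "side s x = side s' x' \<longleftrightarrow> s = s' \<and> x = x'"
  and side_neq_Inl [simp]: "side s x \<noteq> Inl i" "Inl i \<noteq> side s x"
  and side_neq_center [simp]: "side s x \<noteq> center t s'" "center t s' \<noteq> side s x"
  by (auto simp: side_def center_def)

lemma symp_half_conflict: "symp (half_conflict t)"
  by (auto simp: symp_def half_conflict_def)

lemma finite_halves: "finite (halves t n l)"
proof -
  let ?J = "UNIV \<times> {..<max n l}"
  have "halves t n l \<subseteq> range Leaf_end \<union> range Leaf_center \<union> case_prod Arm_center ` ?J \<union>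
          case_prod Arm_inner ` ?J \<union> case_prod Arm_outer ` ?J \<union> case_prod Arm_tip ` ?J \<union>
          Path_half ` {..<2 * t}"
  proof
    fix x assume "x \<in> halves t n l"
    then show "x \<in> range Leaf_end \<union> range Leaf_center \<union> case_prod Arm_center ` ?J \<union>
          case_prod Arm_inner ` ?J \<union> case_prod Arm_outer ` ?J \<union> case_prod Arm_tip ` ?J \<union>
          Path_half ` {..<2 * t}"
      by (cases x) (auto simp: halves_def image_iff split: if_splits)
  qed
  then show ?thesis by (rule finite_subset) auto
qed

text \<open>Equal \<open>i div 2\<close> pairs off \<open>2 * a\<close> with
  \<open>2 * a + 1\<close> (common edge), equal \<open>Suc i div 2\<close> pairs off
  \<open>2 * a + 1\<close> with \<open>2 * a + 2\<close> (common vertex). Hence the conflict graph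
  on the half-edges of the path is again a path.\<close>

lemma div2_eq_iff_consecutive:
  fixes i j :: nat
  shows "i \<noteq> j \<and> (Suc i div 2 = Suc j div 2 \<or> i div 2 = j div 2) \<longleftrightarrow> j = Suc i \<or> i = Suc j"
proof -
  obtain a r where i: "i = 2 * a + r" "r < 2"
    using mult_div_mod_eq[of 2 i, symmetric] mod_less_divisor[of 2 i] by (metis zero_less_numeral)
  obtain b q where j: "j = 2 * b + q" "q < 2"
    using mult_div_mod_eq[of 2 j, symmetric] mod_less_divisor[of 2 j] by (metis zero_less_numeral)
  have "r = 0 \<or> r = 1" "q = 0 \<or> q = 1" using i j by auto
  then show ?thesis using i(1) j(1) by (elim disjE; simp) presburger+
qed

lemma half_conflict_Path_half [simp]:
  "half_conflict t (Path_half i) (Path_half j) \<longleftrightarrow> j = Suc i \<or> i = Suc j"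
  unfolding div2_eq_iff_consecutive[symmetric] by (auto simp: half_conflict_def doubleton_eq_iff)

lemma half_conflict_Leaf_end [simp]:
  "half_conflict t (Leaf_end s) y \<longleftrightarrow> y = Leaf_center s"
  by (cases y) (auto simp: half_conflict_def doubleton_eq_iff)

lemma inj_half: "inj (\<lambda>x. (half_vertex t x, half_edge t x))"
proof (rule injI)
  fix x y assume eq: "(half_vertex t x, half_edge t x) = (half_vertex t y, half_edge t y)"
  show "x = y"
  proof (cases "\<exists>i j. x = Path_half i \<and> y = Path_half j")
    case True
    then obtain i j where ij: "x = Path_half i" "y = Path_half j" by blast
    then have "Suc i div 2 = Suc j div 2" "i div 2 = j div 2"
      using eq by (auto simp: doubleton_eq_iff)
    \<comment> \<open>\<open>Suc i div 2\<close> exceeds \<open>i div 2\<close> exactly when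
      \<open>i\<close> is odd, so the two quotients determine the parity.\<close>
    moreover from this have "even i = even j" by (cases "even i"; cases "even j") auto
    ultimately have "i = j"
      by (metis even_iff_mod_2_eq_zero mod_div_mult_eq odd_iff_mod_2_eq_one)
    then show ?thesis using ij by simp
  next
    case False
    then show ?thesis using eq
      by (cases x; cases y) (auto simp: doubleton_eq_iff)
  qed
qed

section \<open>The graph and its labelled half-edges\<close>

definition star_embedding :: "nat \<Rightarrow> bool \<Rightarrow> star_vertex \<Rightarrow> wedge_vertex" where
  "star_embedding t s x = (if x = Center then center t s else side s x)"

lemma star_embedding_simps:
  "star_embedding t s Center = center t s"
  "star_embedding t s (Leaf i) = side s (Leaf i)"
  "star_embedding t s (Mid j) = side s (Mid j)"
  "star_embedding t s (Tip j) = side s (Tip j)"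
  by (simp_all add: star_embedding_def)

text \<open>\<open>star_embedding t s\<close> is the inclusion of a star into the disjoint union
  followed by \<open>attach_centers t\<close>; the flag lets both stars be treated at once.\<close>

lemma path_wedge_stars_eq:
  "path_wedge_stars t m n k l = image Inl ` path_graph t \<union>
     (\<Union>s. image (star_embedding t s) ` (if s then extended_star k l else extended_star m n))"
proof -
  have *: "attach_centers t \<circ> Inl = Inl"
    "attach_centers t \<circ> (Inr \<circ> Inl) = star_embedding t False"
    "attach_centers t \<circ> (Inr \<circ> Inr) = star_embedding t True"
    by (auto simp: attach_centers_def center_def side_def star_embedding_def fun_eq_iff)
  have **: "image f ` image g ` A = image (f \<circ> g) ` A" for f g and A :: "'z set set"
    by (simp add: image_image comp_def)
  show ?thesis
    unfolding path_wedge_stars_def disjoint_union3_def image_Un ** * UNIV_bool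
    by (simp only: UN_insert UN_empty if_True if_False Un_empty_right Un_assoc)
qed

lemma edges_path_wedge_stars:
  "edges (path_wedge_stars t 1 n 1 l) = half_edge t ` halves t n l"
proof -
  let ?G = "path_wedge_stars t 1 n 1 l"
  show ?thesis
  proof (intro equalityI subsetI)
    fix e assume "e \<in> edges ?G"
    then have e: "e \<in> ?G" "card e = 2" by (auto simp: edges_def)
    then consider \<sigma> where "\<sigma> \<in> path_graph t" "e = Inl ` \<sigma>"
      | s \<sigma> where "\<sigma> \<in> extended_star 1 (if s then l else n)" "e = star_embedding t s ` \<sigma>"
    proof -
      from e(1)[unfolded path_wedge_stars_eq] consider "e \<in> image Inl ` path_graph t"
        | s where "e \<in> image (star_embedding t s) ` (if s then extended_star 1 l else extended_star 1 n)"
        by (elim UnE UN_E)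
      then show thesis
      proof cases
        case 1
        then show thesis using that(1) by blast
      next
        case (2 s)
        then show thesis using that(2)[of _ s] by (cases s) (simp_all only: if_True if_False, blast+)
      qed
    qed
    then show "e \<in> half_edge t ` halves t n l"
    proof cases
      case 1
      then obtain i where "1 \<le> i" "i \<le> t" "e = {Inl (i - 1), Inl i}"
        using e(2) by (auto simp: path_graph_def)
      then have "e = half_edge t (Path_half (2 * (i - 1)))" "Path_half (2 * (i - 1)) \<in> halves t n l"
        by (auto simp: halves_def star_embedding_simps)
      then show ?thesis by blast
    next
      case 2
      then consider "\<sigma> = {Center, Leaf 0}"
        | j where "j < (if s then l else n)" "\<sigma> = {Center, Mid j}"
        | j where "j < (if s then l else n)" "\<sigma> = {Mid j, Tip j}"
        using e(2) by (fastforce simp: extended_star_def)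
      then show ?thesis
      proof cases
        case 1
        then show ?thesis using 2 by (intro image_eqI[of _ _ "Leaf_end s"]) (auto simp: halves_def star_embedding_simps)
      next
        case (2 j)
        then show ?thesis using \<open>e = _\<close>
          by (intro image_eqI[of _ _ "Arm_inner s j"]) (auto simp: halves_def star_embedding_simps)
      next
        case (3 j)
        then show ?thesis using \<open>e = _\<close>
          by (intro image_eqI[of _ _ "Arm_outer s j"]) (auto simp: halves_def star_embedding_simps)
      qed
    qed
  next
    have path: "{Inl i, Inl (Suc i)} \<in> ?G" if "i < t" for i
    proof -
      have "{i, Suc i} \<in> path_graph t" using that by (auto simp: path_graph_def intro!: exI[of _ "Suc i"])
      then have "Inl ` {i, Suc i} \<in> ?G" unfolding path_wedge_stars_eq by blast
      then show ?thesis by simp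
    qed
    have star: "star_embedding t s ` \<sigma> \<in> ?G" if "\<sigma> \<in> extended_star 1 (if s then l else n)" for s \<sigma>
      using that unfolding path_wedge_stars_eq by (cases s) auto
    have leaf: "{center t s, side s (Leaf 0)} \<in> ?G" for s
    proof -
      have "{Center, Leaf 0} \<in> extended_star 1 (if s then l else n)"
        by (auto simp: extended_star_def)
      from star[OF this] show ?thesis
        by (simp only: image_insert image_empty star_embedding_simps)
    qed
    have mid: "{center t s, side s (Mid j)} \<in> ?G" if "j < (if s then l else n)" for s j
    proof -
      have "{Center, Mid j} \<in> extended_star 1 (if s then l else n)"
        using that by (auto simp: extended_star_def)
      from star[OF this] show ?thesis
        by (simp only: image_insert image_empty star_embedding_simps)
    qed
    have tip: "{side s (Mid j), side s (Tip j)} \<in> ?G" if "j < (if s then l else n)" for s j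
    proof -
      have "{Mid j, Tip j} \<in> extended_star 1 (if s then l else n)"
        using that by (auto simp: extended_star_def)
      from star[OF this] show ?thesis
        by (simp only: image_insert image_empty star_embedding_simps)
    qed
    fix e assume "e \<in> half_edge t ` halves t n l"
    then obtain x where x: "e = half_edge t x" "valid_half t n l x"
      by (auto simp: halves_def)
    then have "e \<in> ?G" using path leaf mid tip by (cases x) simp_all
    moreover have "card e = 2" using x(1) by (cases x) simp_all
    ultimately show "e \<in> edges ?G" by (simp add: edges_def)
  qed
qed

text \<open>Each edge carries two labels, one for each end. On the path the even label belongs to
  the lower end and the odd one to the upper.\<close>

lemma half_edges_path_wedge_stars:
  "half_edges (path_wedge_stars t 1 n 1 l) =
     (\<lambda>x. (half_vertex t x, half_edge t x)) ` halves t n l"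
proof (intro equalityI subsetI)
  fix p assume "p \<in> half_edges (path_wedge_stars t 1 n 1 l)"
  then obtain v x where x: "p = (v, half_edge t x)" "v \<in> half_edge t x" "valid_half t n l x"
    unfolding half_edges_def edges_path_wedge_stars by (auto simp: halves_def)
  have "\<exists>y. valid_half t n l y \<and> v = half_vertex t y \<and> half_edge t x = half_edge t y"
  proof (cases x)
    case (Leaf_end s)
    then show ?thesis using x
      by (auto intro: exI[of _ "Leaf_end s"] exI[of _ "Leaf_center s"])
  next
    case (Leaf_center s)
    then show ?thesis using x
      by (auto intro: exI[of _ "Leaf_end s"] exI[of _ "Leaf_center s"])
  next
    case (Arm_center s j)
    then show ?thesis using x
      by (auto intro: exI[of _ "Arm_center s j"] exI[of _ "Arm_inner s j"])
  next
    case (Arm_inner s j)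
    then show ?thesis using x
      by (auto intro: exI[of _ "Arm_center s j"] exI[of _ "Arm_inner s j"])
  next
    case (Arm_outer s j)
    then show ?thesis using x
      by (auto intro: exI[of _ "Arm_outer s j"] exI[of _ "Arm_tip s j"])
  next
    case (Arm_tip s j)
    then show ?thesis using x
      by (auto intro: exI[of _ "Arm_outer s j"] exI[of _ "Arm_tip s j"])
  next
    case (Path_half i)
    then consider "v = Inl (i div 2)" | "v = Inl (Suc (i div 2))" using x by auto
    then show ?thesis
    proof cases
      case 1
      then show ?thesis using x Path_half by (intro exI[of _ "Path_half (2 * (i div 2))"]) auto
    next
      case 2
      have "Suc (2 * (i div 2)) < 2 * t" using x(3) Path_half by simp presburger
      then show ?thesis using 2 Path_half by (intro exI[of _ "Path_half (Suc (2 * (i div 2)))"]) auto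
    qed
  qed
  then show "p \<in> (\<lambda>x. (half_vertex t x, half_edge t x)) ` halves t n l"
    using x(1) by (auto simp: halves_def)
next
  fix p assume "p \<in> (\<lambda>x. (half_vertex t x, half_edge t x)) ` halves t n l"
  then obtain x where x: "p = (half_vertex t x, half_edge t x)" "x \<in> halves t n l" by blast
  have "Suc i div 2 = i div 2 \<or> Suc i div 2 = Suc (i div 2)" for i by presburger
  then have "half_vertex t x \<in> half_edge t x" by (cases x) auto
  then show "p \<in> half_edges (path_wedge_stars t 1 n 1 l)"
    using x unfolding half_edges_def edges_path_wedge_stars by auto
qed

text \<open>Leaves and middle vertices of both stars get height \<open>t + 1\<close>, above the
  whole path, and tips get \<open>t + 2\<close>. Every edge then has a single higher end, and no two
  edges share it.\<close>

lemma unique_top_edges_path_wedge_stars: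
  "unique_top_edges (path_wedge_stars t 1 n 1 l)
     (case_sum id (\<lambda>x. case (case_sum id id x) of Tip _ \<Rightarrow> t + 2 | _ \<Rightarrow> t + 1))"
  (is "unique_top_edges _ ?d")
  unfolding unique_top_edges_def edges_path_wedge_stars
proof (intro ballI impI)
  have d: "?d (Inl i) = i" "?d (side s (Leaf j)) = t + 1" "?d (side s (Mid j)) = t + 1"
    "?d (side s (Tip j)) = t + 2" "?d (center t s) \<le> t" for i j s
    by (auto simp: side_def center_def)
  \<comment> \<open>The higher end of the edge of \<open>x\<close>; the edge can be read off from
    it.\<close>
  define top where "top x = (case x of Leaf_end s \<Rightarrow> side s (Leaf 0) | Leaf_center s \<Rightarrow> side s (Leaf 0)
      | Arm_center s j \<Rightarrow> side s (Mid j) | Arm_inner s j \<Rightarrow> side s (Mid j)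
      | Arm_outer s j \<Rightarrow> side s (Tip j) | Arm_tip s j \<Rightarrow> side s (Tip j)
      | Path_half i \<Rightarrow> Inl (Suc (i div 2)))" for x
  have top: "v = top x" if "v \<in> half_edge t x" "\<forall>w\<in>half_edge t x. ?d w \<le> ?d v" for v x
  proof -
    have "\<not> Suc t \<le> ?d (center t s)" for s using d(5)[of s] by simp
    then show ?thesis using that by (cases x) (auto simp: top_def d)
  qed
  fix e e' v
  assume "e \<in> half_edge t ` halves t n l" "e' \<in> half_edge t ` halves t n l"
    and v: "v \<in> e \<inter> e'" "\<forall>w\<in>e \<union> e'. ?d w \<le> ?d v"
  then obtain x y where xy: "e = half_edge t x" "e' = half_edge t y" by blast
  then have "top x = top y" using top[of v x] top[of v y] v by auto
  then show "e = e'" unfolding xy by (cases x; cases y) (auto simp: top_def)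
qed

lemma morse_complex_path_wedge_stars:
  "geometric_realization (morse_complex (path_wedge_stars t 1 n 1 l))
     homeomorphic_space geometric_realization (independence_complex (halves t n l) (half_conflict t))"
proof -
  let ?\<phi> = "\<lambda>x. {(half_vertex t x, half_edge t x)}"
  have "(\<lambda>p. {p}) ` half_edges (path_wedge_stars t 1 n 1 l) = ?\<phi> ` halves t n l"
    unfolding half_edges_path_wedge_stars by (simp add: image_image)
  moreover have "inj_on ?\<phi> (halves t n l)"
    using inj_half[of t] by (auto simp: inj_def inj_on_def)
  moreover have "(\<exists>p\<in>?\<phi> x. \<exists>q\<in>?\<phi> y. conflict p q) \<longleftrightarrow> half_conflict t x y" for x y
    using inj_half[of t] by (auto simp: conflict_def half_conflict_def inj_def)
  ultimately show ?thesis
    unfolding morse_complex_eq_independence_complex[OF abstract_complex_path_wedge_stars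
        unique_top_edges_path_wedge_stars]
    by (simp only: independence_complex_reindex[OF finite_halves])
qed

section \<open>Reduction of the conflict graph\<close>

lemma half_conflict_commute: "half_conflict t x y \<longleftrightarrow> half_conflict t y x"
  using symp_half_conflict by (metis sympD)

lemma half_conflict_Arm_inner [simp]:
  "half_conflict t (Arm_inner s j) y \<longleftrightarrow> y = Arm_center s j \<or> y = Arm_outer s j"
  by (cases y) (auto simp: half_conflict_def doubleton_eq_iff)

lemma half_conflict_Arm_outer [simp]:
  "half_conflict t (Arm_outer s j) y \<longleftrightarrow> y = Arm_inner s j \<or> y = Arm_tip s j"
  by (cases y) (auto simp: half_conflict_def doubleton_eq_iff)

text \<open>The hypotheses exclude the first and the last half-edge of the path, the only ones at a
  center, so no half-edge of a star interferes.\<close>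

lemma half_conflict_interior:
  assumes "0 < i" "Suc i < 2 * t"
  shows "half_conflict t (Path_half i) y \<longleftrightarrow> y = Path_half (i - 1) \<or> y = Path_half (Suc i)"
proof -
  have "Suc i div 2 \<noteq> 0" "Suc i div 2 \<noteq> t" using assms by auto
  then have c: "Inl (Suc i div 2) \<noteq> center t s" for s by (auto simp: center_def)
  show ?thesis
  proof (cases y)
    case (Path_half j)
    then show ?thesis using assms by auto
  qed (use c in \<open>auto simp: half_conflict_def doubleton_eq_iff\<close>)
qed

text \<open>The centers are distinct. For \<open>t = 0\<close> they coincide and the two half-edges
  would be in conflict, so that case is treated apart.\<close>

lemma half_conflict_Leaf_center_Leaf_center:
  assumes "0 < t"
  shows "\<not> half_conflict t (Leaf_center s) (Leaf_center s')"
  using assms by (auto simp: half_conflict_def doubleton_eq_iff center_def)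

lemma half_conflict_Leaf_center:
  "half_vertex t x = center t s \<Longrightarrow> x \<noteq> Leaf_center s \<Longrightarrow> half_conflict t x (Leaf_center s)"
  by (simp add: half_conflict_def)

text \<open>
  Deleted are the half-edges at the centers other than those of the leaves, dominated by a leaf; the
  tips, dominated by the inner half-edges of their arms; and every third half-edge of the path, the
  one numbered \<open>i\<close> being dominated by \<open>i - 2\<close> once \<open>i - 3\<close> is gone.
\<close>

fun deleted :: "nat \<Rightarrow> half \<Rightarrow> bool" where
  "deleted t (Arm_center s j) = True"
| "deleted t (Arm_tip s j) = True"
| "deleted t (Path_half i) = (i mod 3 = 0 \<or> Suc i = 2 * t)"
| "deleted t x = False"

text \<open>Half-edges at the centers go first. A tip waits for \<open>Arm_center s j\<close>, the
  neighbour of \<open>Arm_inner s j\<close> with which it has no conflict; an inner path half-edge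
  \<open>i\<close> waits for \<open>i - 3\<close>.\<close>

fun deletion_rank :: "nat \<Rightarrow> half \<Rightarrow> nat" where
  "deletion_rank t (Arm_tip s j) = 1"
| "deletion_rank t (Path_half i) = (if Suc i = 2 * t then 0 else i)"
| "deletion_rank t x = 0"

text \<open>For \<open>0 < t\<close> the surviving conflicts join \<open>Leaf_end s\<close> to
  \<open>Leaf_center s\<close>, \<open>Arm_inner s j\<close> to \<open>Arm_outer s j\<close>, and
  the path numbers \<open>3 * j + 1\<close> to \<open>3 * j + 2\<close> below
  \<open>2 * t - 1\<close>.\<close>

definition core :: "nat \<Rightarrow> nat \<Rightarrow> nat \<Rightarrow> half set" where
  "core t n l = {x. valid_half t n l x \<and> \<not> deleted t x}"

lemma independence_complex_halves_core:
  "geometric_realization (independence_complex (halves t n l) (half_conflict t))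
     homotopy_equivalent_space
   geometric_realization (independence_complex (core t n l) (half_conflict t))"
proof -
  let ?H = "halves t n l"
  define D where "D = {x \<in> ?H. deleted t x}"
  have "geometric_realization (independence_complex ?H (half_conflict t))
     homotopy_equivalent_space geometric_realization (independence_complex (?H - D) (half_conflict t))"
  proof (rule independence_complex_fold_ranked[where rank = "deletion_rank t"])
    show "finite ?H" by (rule finite_halves)
    show "symp (half_conflict t)" by (rule symp_half_conflict)
    show "D \<subseteq> ?H" by (auto simp: D_def)
    fix v assume v: "v \<in> D"
    then consider s j where "v = Arm_center s j" | s j where "v = Arm_tip s j"
      | i where "v = Path_half i" "i = 0" | i where "v = Path_half i" "Suc i = 2 * t"
      | i where "v = Path_half i" "i mod 3 = 0" "0 < i" "Suc i < 2 * t"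
    proof (cases v)
      case (Path_half i)
      then have "i = 0 \<or> Suc i = 2 * t \<or> i mod 3 = 0 \<and> 0 < i \<and> Suc i < 2 * t"
        using v by (auto simp: D_def halves_def)
      then show thesis using that(3-5)[OF Path_half] by (elim disjE) simp_all
    qed (use v that(1,2) in \<open>simp_all add: D_def\<close>)
    note cases = this
    \<comment> \<open>The only neighbour of \<open>Leaf_end s\<close> is
      \<open>Leaf_center s\<close>, which is in conflict with every other half-edge at that
      center.\<close>
    have center: "\<exists>u\<in>?H - D. \<forall>w\<in>?H. half_conflict t u w \<longrightarrow>
        half_conflict t v w \<or> w \<in> D \<and> deletion_rank t w < deletion_rank t v"
      if "half_vertex t v = center t s" for s
    proof (rule bexI)
      have "v \<noteq> Leaf_center s" using v by (auto simp: D_def)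
      then show "\<forall>w\<in>?H. half_conflict t (Leaf_end s) w \<longrightarrow>
          half_conflict t v w \<or> w \<in> D \<and> deletion_rank t w < deletion_rank t v"
        using half_conflict_Leaf_center[OF that] by simp
      show "Leaf_end s \<in> ?H - D" by (simp add: D_def halves_def)
    qed
    show "\<exists>u\<in>?H - D. \<forall>w\<in>?H. half_conflict t u w \<longrightarrow>
        half_conflict t v w \<or> w \<in> D \<and> deletion_rank t w < deletion_rank t v"
    proof (cases rule: cases)
      case (1 s j)
      then show ?thesis using center[of s] by simp
    next
      case (2 s j)
      have "half_conflict t (Arm_tip s j) (Arm_outer s j)"
        by (simp add: half_conflict_commute[of t "Arm_tip s j"])
      then show ?thesis using v 2
        by (intro bexI[of _ "Arm_inner s j"]) (simp_all add: D_def halves_def)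
    next
      case 3
      then show ?thesis using center[of False] by (simp add: center_def)
    next
      case (4 i)
      then have "Suc i div 2 = t" by simp
      then show ?thesis using 4 center[of True] by (simp add: center_def)
    next
      case (5 i)
      \<comment> \<open>The dominating half-edge is \<open>i - 2 = 3 * k + 1\<close>. Of its
        neighbours, \<open>3 * k\<close> is deleted with smaller rank and \<open>3 * k + 2\<close>
        is a neighbour of \<open>i\<close>.\<close>
      then obtain k where k: "i = 3 * k + 3"
        by (metis add.commute dvd_eq_mod_eq_0 dvdE mult_Suc_right not0_implies_Suc mult_0_right not_gr0)
      have "(3 * k + 1) mod 3 = 1" by presburger
      then have "Path_half (3 * k + 1) \<in> ?H - D" using 5 k by (auto simp: D_def halves_def)
      moreover have "half_conflict t v w \<or> w \<in> D \<and> deletion_rank t w < deletion_rank t v"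
        if "half_conflict t (Path_half (3 * k + 1)) w" "w \<in> ?H" for w
        using that 5 k half_conflict_interior[of "3 * k + 1" t w] by (auto simp: D_def)
      ultimately show ?thesis by blast
    qed
  qed
  moreover have "?H - D = core t n l" by (auto simp: D_def core_def halves_def)
  ultimately show ?thesis by simp
qed

section \<open>Homotopy types of the reduced complexes\<close>

lemma finite_core: "finite (core t n l)"
  by (rule finite_subset[OF _ finite_halves[of t n l]]) (auto simp: core_def halves_def)

text \<open>The path half-edge \<open>2 * t - 2\<close> is isolated: its neighbours are
  \<open>2 * t - 1\<close>, deleted as the last one, and \<open>2 * t - 3 = 6 * u - 3\<close>,
  deleted as a multiple of 3.\<close>

lemma contractible_core:
  assumes t: "t = 3 * u" "0 < t"
  shows "geometric_realization (independence_complex (core t n l) (half_conflict t))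
           homotopy_equivalent_space discrete_topology {()}"
proof -
  obtain u' where u': "u = Suc u'" using t by (cases u) auto
  have m: "(6 * u' + 4) mod 3 = 1" "(6 * u' + 3) mod 3 = 0" by presburger+
  show ?thesis
  proof (rule independence_complex_isolated[OF finite_core symp_half_conflict])
    show "Path_half (6 * u' + 4) \<in> core t n l" using t u' m by (auto simp: core_def)
    fix w assume "w \<in> core t n l"
    then show "\<not> half_conflict t (Path_half (6 * u' + 4)) w"
      using t u' m half_conflict_interior[of "6 * u' + 4" t w] by (auto simp: core_def)
  qed
qed

text \<open>The centers coincide, so \<open>Leaf_center False\<close>, the only neighbour of
  \<open>Leaf_end False\<close>, is in conflict with \<open>Leaf_center True\<close>. Folding the
  latter away leaves \<open>Leaf_end True\<close> isolated.\<close>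

lemma contractible_halves_0:
  "geometric_realization (independence_complex (halves 0 n l) (half_conflict 0))
     homotopy_equivalent_space discrete_topology {()}"
proof -
  let ?H = "halves 0 n l" and ?v = "Leaf_center True"
  have "geometric_realization (independence_complex ?H (half_conflict 0))
     homotopy_equivalent_space geometric_realization (independence_complex (?H - {?v}) (half_conflict 0))"
    by (rule independence_complex_fold[where u = "Leaf_end False"])
       (auto simp: finite_halves symp_half_conflict, auto simp: halves_def half_conflict_def center_def)
  moreover have "geometric_realization (independence_complex (?H - {?v}) (half_conflict 0))
     homotopy_equivalent_space discrete_topology {()}"
    by (rule independence_complex_isolated[where u = "Leaf_end True"])
       (auto simp: finite_halves symp_half_conflict, simp add: halves_def)
  ultimately show ?thesis by (rule homotopy_eqv_trans)
qed

fun partner :: "half \<Rightarrow> half" where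
  "partner (Leaf_end s) = Leaf_center s"
| "partner (Arm_inner s j) = Arm_outer s j"
| "partner (Path_half i) = Path_half (Suc i)"
| "partner x = x"

text \<open>The core is a matching with 2 edges from the leaves, \<open>n + l\<close> from the arms
  and \<open>k\<close> from the path. The hypothesis on \<open>k\<close> excludes
  \<open>2 * t - 1 = 3 * k + 2\<close>, that is, \<open>t\<close> divisible by 3.\<close>

lemma sphere_core:
  assumes t: "0 < t" and k: "2 * t - 1 = 3 * k \<or> 2 * t - 1 = 3 * k + 1"
  shows "geometric_realization (independence_complex (core t n l) (half_conflict t))
           homeomorphic_space nsphere (n + l + k + 1)"
proof -
  let ?L = "range Leaf_end" and ?P = "(\<lambda>j. Path_half (3 * j + 1)) ` {..<k}"
    and ?N = "Arm_inner False ` {..<n} \<union> Arm_inner True ` {..<l}"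
  define A where "A = ?L \<union> ?N \<union> ?P"
  have "card ?L = 2" by (subst card_image) (auto simp: inj_def)
  moreover have "card ?N = n + l"
    by (subst card_Un_disjoint) (auto simp: card_image inj_on_def)
  moreover have "card ?P = k" by (subst card_image) (auto simp: inj_on_def)
  moreover have "card A = card ?L + card ?N + card ?P"
    unfolding A_def by (subst card_Un_disjoint, auto)+
  ultimately have card: "card A = Suc (n + l + k + 1)" by simp
  \<comment> \<open>Below \<open>2 * t - 1\<close> the residues 1 and 2 both occur exactly
    \<open>k\<close> times, so no path half-edge is left unmatched.\<close>
  have path: "(\<exists>j<k. i = 3 * j + r) \<longleftrightarrow> i mod 3 = r \<and> i < 2 * t - 1" if "r = 1 \<or> r = 2" for i r
  proof
    assume "\<exists>j<k. i = 3 * j + r"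
    then obtain j where "j < k" "i = r + j * 3" by auto
    then show "i mod 3 = r \<and> i < 2 * t - 1" using k that by (auto simp only: mod_mult_self1) auto
  next
    assume i: "i mod 3 = r \<and> i < 2 * t - 1"
    then have "i = 3 * (i div 3) + r" by (metis mult_div_mod_eq)
    moreover from this have "i div 3 < k" using i k that by linarith
    ultimately show "\<exists>j<k. i = 3 * j + r" by blast
  qed
  have A_iff: "x \<in> A \<longleftrightarrow> (case x of Leaf_end s \<Rightarrow> True | Arm_inner s j \<Rightarrow> j < (if s then l else n)
      | Path_half i \<Rightarrow> i mod 3 = 1 \<and> i < 2 * t - 1 | _ \<Rightarrow> False)" for x
  proof (cases x)
    case (Path_half i)
    then have "x \<in> A \<longleftrightarrow> (\<exists>j<k. i = 3 * j + 1)" by (auto simp: A_def)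
    then show ?thesis using Path_half path[of 1 i] by simp
  qed (auto simp: A_def image_iff split: if_splits)
  have partner_A: "partner ` A = range Leaf_center \<union>
      (Arm_outer False ` {..<n} \<union> Arm_outer True ` {..<l}) \<union> (\<lambda>j. Path_half (3 * j + 2)) ` {..<k}"
    by (simp add: A_def image_Un image_image)
  have core_iff: "x \<in> core t n l \<longleftrightarrow> (case x of Leaf_end s \<Rightarrow> True | Leaf_center s \<Rightarrow> True
      | Arm_inner s j \<Rightarrow> j < (if s then l else n) | Arm_outer s j \<Rightarrow> j < (if s then l else n)
      | Path_half i \<Rightarrow> i mod 3 \<noteq> 0 \<and> i < 2 * t - 1 | _ \<Rightarrow> False)" for x
    by (cases x) (auto simp: core_def)
  have core: "core t n l = A \<union> partner ` A"
  proof (intro set_eqI)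
    fix x
    have "x \<in> partner ` A \<longleftrightarrow> (case x of Leaf_center s \<Rightarrow> True
      | Arm_outer s j \<Rightarrow> j < (if s then l else n)
      | Path_half i \<Rightarrow> i mod 3 = 2 \<and> i < 2 * t - 1 | _ \<Rightarrow> False)"
    proof (cases x)
      case (Path_half i)
      then have "x \<in> partner ` A \<longleftrightarrow> (\<exists>j<k. i = 3 * j + 2)" by (auto simp: partner_A)
      then show ?thesis using Path_half path[of 2 i] by simp
    qed (auto simp: partner_A image_iff split: if_splits)
    moreover have "i mod 3 = 0 \<or> i mod 3 = 1 \<or> i mod 3 = 2" for i :: nat by presburger
    ultimately show "x \<in> core t n l \<longleftrightarrow> x \<in> A \<union> partner ` A"
      unfolding Un_iff core_iff A_iff by (cases x) auto
  qed
  show ?thesis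
    unfolding core
  proof (rule independence_complex_matching[OF card])
    show "inj_on partner A"
      by (auto simp: A_def inj_on_def)
    show "A \<inter> partner ` A = {}"
      unfolding A_def by (auto; presburger)
    fix p q assume "p \<in> A \<union> partner ` A" "q \<in> A \<union> partner ` A"
    then have p: "p \<in> core t n l" and q: "q \<in> core t n l" unfolding core by auto
    have "half_conflict t x (partner x)" if "x \<in> A" for x
      using that by (cases x) (auto simp: A_iff)
    moreover have "p \<in> A \<and> q = partner p \<or> q \<in> A \<and> p = partner q" if pq: "half_conflict t p q"
    proof (cases p)
      case (Path_half i)
      then have i: "i mod 3 \<noteq> 0" "i < 2 * t - 1" using p by (auto simp: core_iff)
      then have "0 < i" "Suc i < 2 * t" by (auto intro: gr0I)
      from half_conflict_interior[OF this] pq Path_half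
      \<comment> \<open>A neighbour survives only if its number is not a multiple of 3, so a
        conflict joins a number of residue 1 to its successor.\<close>
      consider "q = Path_half (i - 1)" | "q = Path_half (Suc i)" by blast
      then show ?thesis
      proof cases
        case 1
        then have "(i - 1) mod 3 \<noteq> 0" using q by (auto simp: core_iff)
        moreover have "i mod 3 \<noteq> 0" "Suc (i - 1) = i" using i(1) \<open>0 < i\<close> by auto
        ultimately have "(i - 1) mod 3 = 1"
          using mod_Suc[of "i - 1" 3] mod_less_divisor[of 3 "i - 1"] by (simp split: if_splits)
        then show ?thesis using 1 Path_half i \<open>0 < i\<close> by (auto simp: A_iff)
      next
        case 2
        then have "Suc i mod 3 \<noteq> 0" using q by (auto simp: core_iff)
        then have "i mod 3 = 1"
          using i(1) mod_less_divisor[of 3 i] by (simp add: mod_Suc split: if_splits)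
        then show ?thesis using 2 Path_half i by (auto simp: A_iff)
      qed
    next
      \<comment> \<open>Surviving path half-edges lie at interior vertices and the other leaf hangs
        at another center, so only \<open>Leaf_end s\<close> remains.\<close>
      case (Leaf_center s)
      show ?thesis
      proof (cases q)
        case (Path_half i)
        then have i: "i mod 3 \<noteq> 0" "i < 2 * t - 1" using q by (auto simp: core_iff)
        then have "0 < i" "Suc i < 2 * t" by (auto intro: gr0I)
        moreover have "half_conflict t (Path_half i) (Leaf_center s)"
          using pq Path_half Leaf_center half_conflict_commute by metis
        ultimately show ?thesis by (simp add: half_conflict_interior)
      qed (use pq q t Leaf_center half_conflict_commute[of t p]
            half_conflict_Leaf_center_Leaf_center[OF t] in \<open>auto simp: core_iff A_iff\<close>)
    qed (use pq p q in \<open>auto simp: core_iff A_iff\<close>)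
    ultimately show "half_conflict t p q \<longleftrightarrow> p \<in> A \<and> q = partner p \<or> q \<in> A \<and> p = partner q"
      using half_conflict_commute by blast
  qed
qed

theorem theorem4p2:
  fixes t n l u :: nat
  shows "(t = 3 * u \<longrightarrow>
            geometric_realization (morse_complex (path_wedge_stars t 1 n 1 l))
              homotopy_equivalent_space discrete_topology {()}) \<and>
         (t = 3 * u + 1 \<longrightarrow>
            geometric_realization (morse_complex (path_wedge_stars t 1 n 1 l))
              homotopy_equivalent_space nsphere (n + l + 2 * u + 1)) \<and>
         (t = 3 * u + 2 \<longrightarrow>
            geometric_realization (morse_complex (path_wedge_stars t 1 n 1 l))
              homotopy_equivalent_space nsphere (n + l + 2 * u + 2))"
proof -
  let ?M = "geometric_realization (morse_complex (path_wedge_stars t 1 n 1 l))"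
  let ?H = "geometric_realization (independence_complex (halves t n l) (half_conflict t))"
  let ?C = "geometric_realization (independence_complex (core t n l) (half_conflict t))"
  have MH: "?M homotopy_equivalent_space ?H"
    by (rule homeomorphic_imp_homotopy_equivalent_space[OF morse_complex_path_wedge_stars])
  have MC: "?M homotopy_equivalent_space ?C"
    by (rule homotopy_eqv_trans[OF MH independence_complex_halves_core])
  have sphere: "?M homotopy_equivalent_space nsphere (n + l + k + 1)"
    if "0 < t" "2 * t - 1 = 3 * k \<or> 2 * t - 1 = 3 * k + 1" for k
    by (rule homotopy_eqv_trans[OF MC
          homeomorphic_imp_homotopy_equivalent_space[OF sphere_core[OF that]]])
  have "?M homotopy_equivalent_space discrete_topology {()}" if "t = 3 * u"
  proof (cases "t = 0")
    case True
    then show ?thesis using homotopy_eqv_trans[OF MH] contractible_halves_0 by metis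
  next
    case False
    then show ?thesis using homotopy_eqv_trans[OF MC contractible_core[OF that]] by simp
  qed
  \<comment> \<open>Here \<open>2 * t - 1 = 3 * (2 * u) + 1\<close>, so the path contributes
    \<open>2 * u\<close> edges.\<close>
  moreover have "?M homotopy_equivalent_space nsphere (n + l + 2 * u + 1)" if "t = 3 * u + 1"
    using sphere[of "2 * u"] that by simp
  \<comment> \<open>Here \<open>2 * t - 1 = 3 * (2 * u + 1)\<close>, so the path contributes
    \<open>2 * u + 1\<close> edges.\<close>
  moreover have "?M homotopy_equivalent_space nsphere (n + l + 2 * u + 2)" if "t = 3 * u + 2"
    using sphere[of "2 * u + 1"] that by simp
  ultimately show ?thesis by blast
qed

end
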